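(* Let $X=\{x_i\}_{i\in I}$ with $I$ totally ordered. The set consisting of the generators $x_i$ ($i\in I$) together with all skew-rcom elements $\overline{x_\alpha}$, $\alpha\in\Gamma$, forms a linear basis of $ST(X)$ (equivalently, the elements $\overline{x_\alpha}$, $\alpha\in\Gamma$, form a basis of the part of $ST(X)$ of degree at least $2$). Let $X=\{x_1,\dots,x_q\}$, let $m_1,\dots,m_q$ be positive integers with $n=m_1+\cdots+m_q\ge 2$, and let $ST(X)_{m_1,\dots,m_q}$ be the homogeneous part of $ST(X)$ of degree $m_i$ in $x_i$ for $i=1,\dots,q$. Then $$\dim ST(X)_{m_1,\dots,m_q}=\sum_{1\le i<j\le q}\frac{(n-2)!}{m_1!\cdots m_q!}\,m_im_j .$$ In particular, for $q\ge 2$ the multilinear part of $ST(X)$ (the case $m_1=\cdots=m_q=1$) has dimension $\frac{q!}{2}$.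
   Context: All algebras are over a field $\mathbf{K}$ of characteristic $0$. A (right-)Zinbiel algebra is a (non-unital, non-associative) algebra with product $\circ$ satisfying $a\circ(b\circ c)=(a\circ b+b\circ a)\circ c$. $Zin(X)$ is the free Zinbiel algebra on the set $X$. For $a_1,\dots,a_n\in Zin(X)$, $a_1a_2\cdots a_n$ denotes the left-bracketed product $(\cdots(a_1\circ a_2)\circ\cdots)\circ a_n$. It is known (Loday) that the left-bracketed words $x_{i_1}x_{i_2}\cdots x_{i_n}$ ($n\ge 1$) in elements of $X$ form a linear basis of $Zin(X)$. $ST(X)$, the free special Tortkara algebra on $X$, is the subalgebra of $Zin(X)^{(-)}=(Zin(X),[\,,])$, $[a,b]=a\circ b-b\circ a$, generated by $X$. The linear map $p:Zin(X)\to Zin(X)$ is defined on the basis of words by $p(x)=-x$ for $x\in X$; $p(yz)=zy$ for $y,z\in X$; and $p(x_{i_1}\cdots x_{i_m}yz)=x_{i_1}\cdots x_{i_m}zy$ for $m\ge1$ and $y,z\in X$. Set $\overline{a}=a-p(a)$. $\Gamma$ is the set of all finite sequences $\alpha=i_1\cdots i_{n-1}i_n$ of indices, $n>1$, with $i_{n-1}<i_n$. For $\alpha=i_1\cdots i_n\in\Gamma$ put $x_\alpha=x_{i_1}\cdots x_{i_{n-1}}x_{i_n}$. The elements $\overline{x_\alpha}=x_{i_1}\cdots x_{i_{n-2}}x_{i_{n-1}}x_{i_n}-x_{i_1}\cdots x_{i_{n-2}}x_{i_n}x_{i_{n-1}}$, $\alpha\in\Gamma$, are called skew-rcom (skew-right-commutative)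 elements. *)

theory Defs
  imports Complex_Main "HOL-Library.Poly_Mapping"
begin

section \<open>Zinbiel algebras\<close>

text \<open>A (right) Zinbiel algebra over a field of characteristic 0, carried by a subspace
  \<open>A\<close> of a vector space (so that it need not fill a whole type).\<close>

locale zinbiel_algebra = vector_space scale
  for scale :: "'k::field_char_0 \<Rightarrow> 'a::ab_group_add \<Rightarrow> 'a" +
  fixes mul :: "'a \<Rightarrow> 'a \<Rightarrow> 'a" and A :: "'a set"
  assumes subspace_carrier: "subspace A"
    and mul_closed: "a \<in> A \<Longrightarrow> b \<in> A \<Longrightarrow> mul a b \<in> A"
    and mul_add_left: "a \<in> A \<Longrightarrow> b \<in> A \<Longrightarrow> c \<in> A \<Longrightarrow> mul (a + b) c = mul a c + mul b c"
    and mul_add_right: "a \<in> A \<Longrightarrow> b \<in> A \<Longrightarrow> c \<in> A \<Longrightarrow> mul a (b + c) = mul a b + mul a c"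
    and mul_scale_left: "a \<in> A \<Longrightarrow> b \<in> A \<Longrightarrow> mul (scale k a) b = scale k (mul a b)"
    and mul_scale_right: "a \<in> A \<Longrightarrow> b \<in> A \<Longrightarrow> mul a (scale k b) = scale k (mul a b)"
    and zinbiel: "a \<in> A \<Longrightarrow> b \<in> A \<Longrightarrow> c \<in> A \<Longrightarrow> mul a (mul b c) = mul (mul a b + mul b a) c"

definition alg_hom ::
  "('k \<Rightarrow> 'a \<Rightarrow> 'a) \<Rightarrow> ('a::ab_group_add \<Rightarrow> 'a \<Rightarrow> 'a) \<Rightarrow> 'a set \<Rightarrow>
   ('k \<Rightarrow> 'b \<Rightarrow> 'b) \<Rightarrow> ('b::ab_group_add \<Rightarrow> 'b \<Rightarrow> 'b) \<Rightarrow> 'b set \<Rightarrow> ('a \<Rightarrow> 'b) \<Rightarrow> bool" where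
  "alg_hom sc mul A sc' mul' B h \<longleftrightarrow>
     (\<forall>a\<in>A. h a \<in> B) \<and>
     (\<forall>a\<in>A. \<forall>b\<in>A. h (a + b) = h a + h b) \<and>
     (\<forall>k. \<forall>a\<in>A. h (sc k a) = sc' k (h a)) \<and>
     (\<forall>a\<in>A. \<forall>b\<in>A. h (mul a b) = mul' (h a) (h b))"


section \<open>The free Zinbiel algebra\<close>

text \<open>The free Zinbiel algebra is realised by Loday's half-shuffle model: finite linear
  combinations of nonempty words, the word \<open>[x, y, z]\<close> being the left-bracketed product
  \<open>(x \<circ> y) \<circ> z\<close> of its letters (lemma \<open>lbr_eq_word\<close>). That the model is a Zinbiel algebra
  with the universal property of the free one is proved below (\<open>zinbiel_algebra_zin\<close>,
  \<open>zin_universal_existence\<close>, \<open>zin_universal_uniqueness\<close>). The empty word is excluded from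
  \<open>zin I\<close>, the free algebra on the generators \<open>gen i\<close> with \<open>i \<in> I\<close>; values of the
  operations involving it are irrelevant.\<close>

type_synonym ('i, 'k) zin = "'i list \<Rightarrow>\<^sub>0 'k"

definition zscale :: "'k::field_char_0 \<Rightarrow> ('i, 'k) zin \<Rightarrow> ('i, 'k) zin" where
  "zscale c = Poly_Mapping.map ((*) c)"

lemma lookup_zscale [simp]:
  "Poly_Mapping.lookup (zscale c f) w = c * Poly_Mapping.lookup f w"
  by (simp add: zscale_def Poly_Mapping.map.rep_eq when_def)

interpretation zin: vector_space zscale
  by unfold_locales (auto intro!: poly_mapping_eqI simp: lookup_add algebra_simps)

definition word :: "'i list \<Rightarrow> ('i, 'k::field_char_0) zin" where
  "word w = Poly_Mapping.single w 1"

definition gen :: "'i \<Rightarrow> ('i, 'k::field_char_0) zin" where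
  "gen i = word [i]"

definition zin :: "'i set \<Rightarrow> ('i, 'k::field_char_0) zin set" where
  "zin I = {a. \<forall>w\<in>Poly_Mapping.keys a. w \<noteq> [] \<and> set w \<subseteq> I}"

definition lin :: "('k::field_char_0 \<Rightarrow> 'b \<Rightarrow> 'b) \<Rightarrow> ('i list \<Rightarrow> 'b) \<Rightarrow> ('i, 'k) zin \<Rightarrow> 'b::ab_group_add" where
  "lin sc F a = (\<Sum>w\<in>Poly_Mapping.keys a. sc (Poly_Mapping.lookup a w) (F w))"

text \<open>All shuffles of two words, listed with multiplicity.\<close>

function shuffle_list :: "'i list \<Rightarrow> 'i list \<Rightarrow> 'i list list" where
  "shuffle_list u v =
     (if u = [] then [v] else if v = [] then [u]
      else map (\<lambda>w. w @ [last u]) (shuffle_list (butlast u) v) @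
           map (\<lambda>w. w @ [last v]) (shuffle_list u (butlast v)))"
  by auto
termination by (relation "measure (\<lambda>(u, v). length u + length v)") auto

declare shuffle_list.simps [simp del]

text \<open>The half-shuffle of \<open>u\<close> and \<open>v\<close> keeps those shuffles that end with the last letter of \<open>v\<close>.\<close>

definition half_shuffle :: "'i list \<Rightarrow> 'i list \<Rightarrow> ('i, 'k::field_char_0) zin" where
  "half_shuffle u v =
     (if v = [] then 0 else (\<Sum>w\<leftarrow>shuffle_list u (butlast v). word (w @ [last v])))"

definition zmul :: "('i, 'k::field_char_0) zin \<Rightarrow> ('i, 'k) zin \<Rightarrow> ('i, 'k) zin"  (infixl "\<odot>" 70) where
  "a \<odot> b = lin zscale (\<lambda>u. lin zscale (\<lambda>v. half_shuffle u v) b) a"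

definition lbr :: "'i list \<Rightarrow> ('i, 'k::field_char_0) zin" where
  "lbr w = foldl (\<odot>) (gen (hd w)) (map gen (tl w))"


subsection \<open>It is a Zinbiel algebra\<close>

lemma zin_cong_keys:
  assumes "finite S" "Poly_Mapping.keys a \<subseteq> S" "vector_space sc"
  shows "lin sc F a = (\<Sum>w\<in>S. sc (Poly_Mapping.lookup a w) (F w))"
proof -
  interpret vector_space sc by fact
  show ?thesis unfolding lin_def
    using assms by (intro sum.mono_neutral_left) (auto simp: in_keys_iff)
qed

lemma lin_add: assumes "vector_space sc" shows "lin sc F (a + b) = lin sc F a + lin sc F b"
proof -
  interpret vector_space sc by fact
  let ?S = "Poly_Mapping.keys a \<union> Poly_Mapping.keys b"
  have "Poly_Mapping.keys (a + b) \<subseteq> ?S" by (rule keys_add)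
  then show ?thesis
    by (simp add: zin_cong_keys[OF _ _ assms, of ?S] lookup_add scale_left_distrib sum.distrib)
qed

lemma lin_scale: assumes "vector_space sc" shows "lin sc F (zscale k a) = sc k (lin sc F a)"
proof -
  interpret vector_space sc by fact
  let ?S = "Poly_Mapping.keys a"
  have "Poly_Mapping.keys (zscale k a) \<subseteq> ?S" by (auto simp: in_keys_iff)
  then show ?thesis
    by (simp add: zin_cong_keys[OF _ _ assms, of ?S] scale_sum_right)
qed

lemma lin_word: assumes "vector_space sc" shows "lin sc F (word w) = F w"
proof -
  interpret vector_space sc by fact
  show ?thesis by (simp add: lin_def word_def)
qed

lemma lin_zero: "lin sc F 0 = 0"
  by (simp add: lin_def)

lemma zin_expand: "a = (\<Sum>w\<in>Poly_Mapping.keys a. zscale (Poly_Mapping.lookup a w) (word w))"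
proof (rule poly_mapping_eqI)
  fix v
  have "Poly_Mapping.lookup (\<Sum>w\<in>Poly_Mapping.keys a. zscale (Poly_Mapping.lookup a w) (word w)) v
      = (\<Sum>w\<in>Poly_Mapping.keys a. Poly_Mapping.lookup a w * (1 when w = v))"
    by (simp add: lookup_sum word_def lookup_single)
  also have "\<dots> = (\<Sum>w\<in>Poly_Mapping.keys a. if w = v then Poly_Mapping.lookup a v else 0)"
    by (intro sum.cong) (auto simp: when_def)
  also have "\<dots> = Poly_Mapping.lookup a v"
    by (simp add: in_keys_iff)
  finally show "Poly_Mapping.lookup a v =
    Poly_Mapping.lookup (\<Sum>w\<in>Poly_Mapping.keys a. zscale (Poly_Mapping.lookup a w) (word w)) v" ..
qed

lemma word_induct:
  fixes a :: "('i, 'k::field_char_0) zin"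
  assumes "P 0" "\<And>k w b. w \<in> Poly_Mapping.keys a \<Longrightarrow> P b \<Longrightarrow>
     Poly_Mapping.keys b \<subseteq> Poly_Mapping.keys a \<Longrightarrow> P (zscale k (word w) + b)"
  shows "P a"
proof -
  let ?s = "\<lambda>S. (\<Sum>w\<in>S. zscale (Poly_Mapping.lookup a w) (word w)) :: ('i, 'k) zin"
  have "P (?s S) \<and> Poly_Mapping.keys (?s S) \<subseteq> Poly_Mapping.keys a"
    if "S \<subseteq> Poly_Mapping.keys a" for S
  proof -
    have "finite S" using that finite_subset finite_keys by blast
    then show ?thesis using that
    proof (induction S rule: finite_induct)
      case empty then show ?case using assms(1) by simp
    next
      case (insert x S)
      have "Poly_Mapping.keys (zscale (Poly_Mapping.lookup a x) (word x)) \<subseteq> {x}"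
        by (auto simp: in_keys_iff word_def lookup_single when_def split: if_splits)
      then show ?case
        using insert assms(2)[of x "?s S"]
          keys_add[of "zscale (Poly_Mapping.lookup a x) (word x)" "?s S"] by auto
    qed
  qed
  from this[OF subset_refl] show ?thesis using zin_expand[of a] by metis
qed

lemmas vs = zin.vector_space_axioms
lemmas zlin_simps = lin_add[OF vs] lin_scale[OF vs] lin_word[OF vs] lin_zero

lemma lin_addF: assumes "vector_space sc"
  shows "lin sc (\<lambda>w. F w + G w) a = lin sc F a + lin sc G a"
proof -
  interpret vector_space sc by fact
  show ?thesis by (simp add: lin_def scale_right_distrib sum.distrib)
qed

lemma lin_scaleF: assumes "vector_space sc"
  shows "lin sc (\<lambda>w. sc k (F w)) a = sc k (lin sc F a)"
proof -
  interpret vector_space sc by fact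
  show ?thesis by (simp add: lin_def scale_sum_right mult.commute)
qed

lemma lin_0F: assumes "vector_space sc"
  shows "lin sc (\<lambda>w. 0) a = 0"
proof -
  interpret vector_space sc by fact
  show ?thesis by (simp add: lin_def)
qed

definition bil :: "('i list \<Rightarrow> 'i list \<Rightarrow> ('i, 'k) zin) \<Rightarrow>
    ('i, 'k::field_char_0) zin \<Rightarrow> ('i, 'k) zin \<Rightarrow> ('i, 'k) zin" where
  "bil F a b = lin zscale (\<lambda>u. lin zscale (F u) b) a"

lemma bil_simps:
  "bil F 0 b = 0" "bil F a 0 = 0"
  "bil F (a + a') b = bil F a b + bil F a' b"
  "bil F a (b + b') = bil F a b + bil F a b'"
  "bil F (zscale k a) b = zscale k (bil F a b)"
  "bil F a (zscale k b) = zscale k (bil F a b)"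
  "bil F (word u) (word v) = F u v"
  by (simp_all add: bil_def zlin_simps lin_addF[OF vs] lin_scaleF[OF vs] lin_0F[OF vs])

lemma zmul_bil: "a \<odot> b = bil half_shuffle a b"
  by (simp add: zmul_def bil_def)

lemmas zmul_simps = bil_simps[of half_shuffle, folded zmul_bil]

definition shw :: "'i list \<Rightarrow> 'i list \<Rightarrow> ('i, 'k::field_char_0) zin" where
  "shw u v = (\<Sum>w\<leftarrow>shuffle_list u v. word w)"

definition app :: "'i \<Rightarrow> ('i, 'k::field_char_0) zin \<Rightarrow> ('i, 'k) zin" where
  "app z = lin zscale (\<lambda>w. word (w @ [z]))"

lemma app_simps: "app z 0 = 0" "app z (a + b) = app z a + app z b"
  "app z (zscale k a) = zscale k (app z a)" "app z (word w) = word (w @ [z])"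
  by (simp_all add: app_def zlin_simps)

lemma app_sum_list: "app z (\<Sum>w\<leftarrow>ws. word w) = (\<Sum>w\<leftarrow>ws. word (w @ [z]))"
  by (induction ws) (simp_all add: app_simps)

lemma shw_simps:
  "shw [] v = word v" "shw u [] = word u"
  "shw (u @ [x]) (v @ [y]) = app x (shw u (v @ [y])) + app y (shw (u @ [x]) v)"
  by (simp_all add: shw_def shuffle_list.simps[of "[]"] shuffle_list.simps[of _ "[]"]
     shuffle_list.simps[of "u @ [x]" "v @ [y]"] app_sum_list comp_def)

lemma half_shuffle_snoc: "half_shuffle u (v @ [z]) = app z (shw u v)"
  by (simp add: half_shuffle_def shw_def app_sum_list)

lemma shw_commute: "shw u v = (shw v u :: ('i, 'k::field_char_0) zin)"
proof (induction "length u + length v" arbitrary: u v rule: less_induct)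
  case less
  show ?case
  proof (cases u rule: rev_cases)
    case Nil then show ?thesis by (simp add: shw_simps)
  next
    case u: (snoc u' x)
    show ?thesis
    proof (cases v rule: rev_cases)
      case Nil then show ?thesis by (simp add: shw_simps)
    next
      case v: (snoc v' y)
      have "shw u' v = (shw v u' :: ('i, 'k) zin)" "shw u v' = (shw v' u :: ('i, 'k) zin)"
        using less.hyps[of u' v] less.hyps[of u v'] by (simp_all add: u v)
      then show ?thesis by (simp add: u v shw_simps add.commute)
    qed
  qed
qed

lemma shm_commute: "bil shw a b = bil shw b a"
proof (induction a rule: word_induct)
  case (2 k w a)
  have "bil shw (word w) b = bil shw b (word w)"
    by (induction b rule: word_induct) (simp_all add: bil_simps shw_commute)
  with 2 show ?case by (simp add: bil_simps)
qed (simp add: bil_simps)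

lemma shm_app:
  "bil shw (word (u @ [x])) (app y b) = app x (bil shw (word u) (app y b)) + app y (bil shw (word (u @ [x])) b)"
  by (induction b rule: word_induct)
    (simp_all add: bil_simps app_simps shw_simps algebra_simps)

lemma shm_Nil: "bil shw (word []) b = b"
  by (induction b rule: word_induct) (simp_all add: bil_simps shw_simps)

lemma shm_app': 
  "bil shw (app y b) (word (u @ [x])) = app x (bil shw (app y b) (word u)) + app y (bil shw b (word (u @ [x])))"
  by (simp only: shm_app shm_commute[of "app y b" "word (u @ [x])"]
      shm_commute[of "app y b" "word u"] shm_commute[of b "word (u @ [x])"])

lemma shm_assoc_word:
  "bil shw (word a) (bil shw (word b) (word c)) =
   (bil shw (bil shw (word a) (word b)) (word c) :: ('i, 'k::field_char_0) zin)"
proof (induction "length a + length b + length c" arbitrary: a b c rule: less_induct)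
  case less
  consider "a = []" | "b = []" | "c = []" | a' x b' y c' z where "a = a' @ [x]" "b = b' @ [y]" "c = c' @ [z]"
    by (metis rev_exhaust)
  then show ?case
  proof cases
    case 1 then show ?thesis by (simp add: shm_Nil)
  next
    case 2 then show ?thesis by (simp add: shm_Nil shm_commute[of "word a"])
  next
    case 3 then show ?thesis by (simp add: shm_Nil shm_commute[of _ "word []"])
  next
    case 4
    let ?m = "bil shw :: ('i, 'k) zin \<Rightarrow> ('i, 'k) zin \<Rightarrow> ('i, 'k) zin"
    have IH: "?m (word a') (?m (word b) (word c)) = ?m (?m (word a') (word b)) (word c)"
      "?m (word a) (?m (word b') (word c)) = ?m (?m (word a) (word b')) (word c)"
      "?m (word a) (?m (word b) (word c')) = ?m (?m (word a) (word b)) (word c')"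
      using less.hyps[of a' b c] less.hyps[of a b' c] less.hyps[of a b c'] by (simp_all add: 4)
    have bc: "?m (word b) (word c) = app y (?m (word b') (word c)) + app z (?m (word b) (word c'))"
      by (simp add: 4 bil_simps shw_simps)
    have ab: "?m (word a) (word b) = app x (?m (word a') (word b)) + app y (?m (word a) (word b'))"
      by (simp add: 4 bil_simps shw_simps)
    have "?m (word a) (?m (word b) (word c)) =
        app x (?m (word a') (?m (word b) (word c))) + app y (?m (word a) (?m (word b') (word c)))
        + app z (?m (word a) (?m (word b) (word c')))"
      unfolding bc bil_simps(1-6)
      by (simp add: 4(1) shm_app app_simps add.assoc add.left_commute)
    moreover have "?m (?m (word a) (word b)) (word c) =
        app x (?m (?m (word a') (word b)) (word c)) + app y (?m (?m (word a) (word b')) (word c))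
        + app z (?m (?m (word a) (word b)) (word c'))"
      unfolding ab bil_simps(1-6)
      by (simp add: 4(3) shm_app' app_simps add.assoc add.left_commute)
    ultimately show ?thesis by (simp add: IH)
  qed
qed

lemma zmul_app: "word u \<odot> app z b = app z (bil shw (word u) b)"
  by (induction b rule: word_induct) (simp_all add: bil_simps app_simps zmul_simps half_shuffle_snoc)

lemma zmul_snoc: "a \<odot> word (v @ [z]) = app z (bil shw a (word v))"
  by (induction a rule: word_induct) (simp_all add: bil_simps app_simps zmul_simps half_shuffle_snoc)

lemma word_gen: "a \<odot> word [z] = app z a"
  using zmul_snoc[of a "[]" z] by (simp add: shm_commute[of a] shm_Nil)

lemma zinbiel_word:
  assumes "a \<noteq> []" "b \<noteq> []" "c \<noteq> []"
  shows "word a \<odot> (word b \<odot> word c) = (word a \<odot> word b + word b \<odot> word a) \<odot> word c"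
proof -
  obtain a' x b' y c' z where *: "a = a' @ [x]" "b = b' @ [y]" "c = c' @ [z]"
    using assms by (metis rev_exhaust)
  have ab: "word a \<odot> word b + word b \<odot> word a = bil shw (word a) (word b)"
    unfolding *(1,2) zmul_snoc
    by (simp add: bil_simps shw_simps shw_commute[of "b' @ [y]"] add.commute)
  show ?thesis
    unfolding ab by (simp add: *(3) zmul_snoc zmul_app shm_assoc_word)
qed

lemma subspace_zin: "zin.subspace (zin I :: ('b, 'a::field_char_0) zin set)"
proof (rule zin.subspaceI)
  show "0 \<in> zin I" by (simp add: zin_def)
next
  fix x y :: "('b, 'a) zin" assume "x \<in> zin I" "y \<in> zin I"
  then show "x + y \<in> zin I"
    using keys_add[of x y] unfolding zin_def by fast
next
  fix c and x :: "('b, 'a) zin" assume x: "x \<in> zin I"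
  have "Poly_Mapping.keys (zscale c x) \<subseteq> Poly_Mapping.keys x" by (auto simp: in_keys_iff)
  with x show "zscale c x \<in> zin I" unfolding zin_def by fast
qed

lemma word_in_zin [simp]: "word w \<in> zin I \<longleftrightarrow> w \<noteq> [] \<and> set w \<subseteq> I"
  by (simp add: zin_def word_def)

lemma zin_induct [consumes 1, case_names zero add]:
  assumes "a \<in> zin I" "P 0"
    "\<And>k w b. w \<noteq> [] \<Longrightarrow> set w \<subseteq> I \<Longrightarrow> b \<in> zin I \<Longrightarrow> P b \<Longrightarrow> P (zscale k (word w) + b)"
  shows "P a"
proof (induction a rule: word_induct)
  case (2 k w b)
  then show ?case using assms(1) assms(3)[of w b k] by (auto simp: zin_def)
qed (rule assms(2))

lemmas zin_closed = zin.subspace_add[OF subspace_zin] zin.subspace_scale[OF subspace_zin]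
  zin.subspace_0[OF subspace_zin]

lemma zinbiel_zin:
  fixes a b c :: "('i, 'k::field_char_0) zin"
  assumes "a \<in> zin I" "b \<in> zin I" "c \<in> zin I"
  shows "a \<odot> (b \<odot> c) = (a \<odot> b + b \<odot> a) \<odot> c"
  using assms(3)
proof (induction c rule: zin_induct)
  case (add k w c)
  have "a \<odot> (b \<odot> word w) = (a \<odot> b + b \<odot> a) \<odot> word w"
    using assms(2)
  proof (induction b rule: zin_induct)
    case (add k' v b)
    have "a \<odot> (word v \<odot> word w) = (a \<odot> word v + word v \<odot> a) \<odot> word w"
      using assms(1)
    proof (induction a rule: zin_induct)
      case (add k'' u a)
      moreover have "word u \<odot> (word v \<odot> word w) =
          ((word u \<odot> word v + word v \<odot> word u) \<odot> word w :: ('i, 'k) zin)"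
        by (rule zinbiel_word) fact+
      ultimately show ?case
        by (simp add: zmul_simps(1-6) zin.scale_right_distrib add_ac)
    qed (simp add: zmul_simps(1-6))
    with add show ?case by (simp add: zmul_simps(1-6) zin.scale_right_distrib add_ac)
  qed (simp add: zmul_simps(1-6))
  with add show ?case by (simp add: zmul_simps(1-6) zin.scale_right_distrib add_ac)
qed (simp add: zmul_simps(1-6))

lemma set_shuffle_list: "w \<in> set (shuffle_list u v) \<Longrightarrow> set w \<subseteq> set u \<union> set v"
proof (induction u v arbitrary: w rule: shuffle_list.induct)
  case (1 u v)
  have b: "set (butlast u) \<subseteq> set u" "set (butlast v) \<subseteq> set v"
    by (auto dest: in_set_butlastD)
  consider "u = []" | "v = []" | "u \<noteq> []" "v \<noteq> []" by blast
  then show ?case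
  proof cases
    case 3
    have "w \<in> (\<lambda>w. w @ [last u]) ` set (shuffle_list (butlast u) v) \<union>
              (\<lambda>w. w @ [last v]) ` set (shuffle_list u (butlast v))"
      using "1.prems" 3 shuffle_list.simps[of u v] by simp
    then show ?thesis
    proof
      assume "w \<in> (\<lambda>w. w @ [last u]) ` set (shuffle_list (butlast u) v)"
      then obtain w' where "w = w' @ [last u]" "w' \<in> set (shuffle_list (butlast u) v)" by blast
      then show ?thesis using "1.IH"(1)[OF 3, of w'] b(1) last_in_set[OF 3(1)] by auto
    next
      assume "w \<in> (\<lambda>w. w @ [last v]) ` set (shuffle_list u (butlast v))"
      then obtain w' where "w = w' @ [last v]" "w' \<in> set (shuffle_list u (butlast v))" by blast
      then show ?thesis using "1.IH"(2)[OF 3, of w'] b(2) last_in_set[OF 3(2)] by auto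
    qed
  qed (use "1.prems" in \<open>simp_all add: shuffle_list.simps[of "[]"] shuffle_list.simps[of _ "[]"] split: if_splits\<close>)
qed

lemma half_shuffle_in_zin:
  assumes "set u \<subseteq> I" "set v \<subseteq> I"
  shows "half_shuffle u v \<in> zin I"
proof (cases "v = []")
  case False
  then have last: "last v \<in> I" using assms(2) last_in_set by blast
  have "(\<Sum>w\<leftarrow>ws. word (w @ [last v])) \<in> zin I" if "\<forall>w\<in>set ws. set w \<subseteq> I" for ws
    using that assms last by (induction ws) (auto intro!: zin_closed)
  moreover have "\<forall>w\<in>set (shuffle_list u (butlast v)). set w \<subseteq> I"
    using set_shuffle_list assms by (fastforce dest: in_set_butlastD)
  ultimately show ?thesis using False by (simp add: half_shuffle_def)
qed (simp add: half_shuffle_def zin_closed)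

lemma zmul_in_zin:
  assumes "a \<in> zin I" "b \<in> zin I" shows "a \<odot> b \<in> zin I"
  using assms(1)
proof (induction a rule: zin_induct)
  case (add k u a)
  have "word u \<odot> b \<in> zin I" using assms(2)
    by (induction b rule: zin_induct)
      (use add in \<open>auto simp: zmul_simps intro!: zin_closed half_shuffle_in_zin\<close>)
  with add show ?case by (auto simp: zmul_simps intro!: zin_closed)
qed (simp add: zmul_simps zin_closed)

theorem zinbiel_algebra_zin: "zinbiel_algebra zscale (\<odot>) (zin I)"
  by unfold_locales (simp_all add: subspace_zin zmul_in_zin zinbiel_zin, simp_all add: zmul_simps)

theorem lbr_eq_word: "w \<noteq> [] \<Longrightarrow> lbr w = word w"
proof (induction w rule: rev_nonempty_induct)
  case (snoc x xs)
  then show ?case by (simp add: lbr_def gen_def word_gen app_simps)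
qed (simp add: lbr_def gen_def)


subsection \<open>It is free\<close>

lemma (in zinbiel_algebra) carrier_closed:
  "0 \<in> A" "a \<in> A \<Longrightarrow> b \<in> A \<Longrightarrow> a + b \<in> A" "a \<in> A \<Longrightarrow> scale k a \<in> A"
  using subspace_carrier by (auto simp: subspace_def)

lemma (in zinbiel_algebra) mul_zero: "a \<in> A \<Longrightarrow> mul 0 a = 0" "a \<in> A \<Longrightarrow> mul a 0 = 0"
  using mul_scale_left[of 0 a 0] mul_scale_right[of a 0 0] carrier_closed(1) by simp_all

theorem zin_universal_existence:
  fixes scale :: "'k::field_char_0 \<Rightarrow> 'b::ab_group_add \<Rightarrow> 'b" and I :: "'i set"
  assumes "zinbiel_algebra scale mul A" and f: "\<forall>i\<in>I. f i \<in> A"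
  shows "\<exists>h. alg_hom zscale (\<odot>) (zin I) scale mul A h \<and> (\<forall>i\<in>I. h (gen i) = f i)"
proof -
  interpret zinbiel_algebra scale mul A by fact
  note vsA = vector_space_axioms
  define W where "W w = foldl mul (f (hd w)) (map f (tl w))" for w
  define h :: "('i, 'k) zin \<Rightarrow> 'b" where "h = lin scale W"
  have h_simps: "h 0 = 0" "h (a + b) = h a + h b" "h (zscale k a) = scale k (h a)" "h (word w) = W w" for a b k w
    by (simp_all add: h_def lin_zero lin_add[OF vsA] lin_scale[OF vsA] lin_word[OF vsA])
  have Wsnoc: "W (w @ [x]) = mul (W w) (f x)" if "w \<noteq> []" for w x
    using that by (simp add: W_def)
  have W1: "W [x] = f x" for x by (simp add: W_def)
  have WA: "W w \<in> A" if "w \<noteq> []" "set w \<subseteq> I" for w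
    using that by (induction w rule: rev_nonempty_induct) (auto simp: W1 Wsnoc f intro!: mul_closed)
  have hA: "h a \<in> A" if "a \<in> zin I" for a
    using that by (induction a rule: zin_induct) (auto simp: h_simps WA intro!: carrier_closed)
  have h1: "h (a \<odot> word [z]) = mul (h a) (f z)" if "a \<in> zin I" "z \<in> I" for a z
    using that
  proof (induction a rule: zin_induct)
    case (add k w b)
    then show ?case
      by (simp add: word_gen app_simps h_simps Wsnoc mul_add_left mul_scale_left hA WA f carrier_closed)
  qed (simp add: zmul_simps h_simps mul_zero f)
  have hw: "h (word u \<odot> word v) = mul (W u) (W v)"
    if "u \<noteq> []" "v \<noteq> []" "set u \<subseteq> I" "set v \<subseteq> I" for u v
    using that
  proof (induction "length u + length v" arbitrary: u v rule: less_induct)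
    case less
    obtain v' z where v: "v = v' @ [z]" using less.prems by (metis rev_exhaust)
    show ?case
    proof (cases "v' = []")
      case True
      then show ?thesis using less.prems h1[of "word u" z] by (simp add: v W1 h_simps)
    next
      case False
      have IH: "h (word u \<odot> word v') = mul (W u) (W v')" "h (word v' \<odot> word u) = mul (W v') (W u)"
        using less.prems False by (intro less.hyps; simp add: v)+
      have wv: "(word v :: ('i, 'k) zin) = word v' \<odot> word [z]"
        by (simp add: v word_gen app_simps)
      have "word u \<odot> word v = ((word u \<odot> word v' + word v' \<odot> word u) \<odot> word [z] :: ('i, 'k) zin)"
        unfolding wv using less.prems False by (intro zinbiel_word) auto
      then have "h (word u \<odot> word v) = mul (mul (W u) (W v') + mul (W v') (W u)) (f z)"
        using less.prems False IH by (simp add: v h1 zmul_in_zin zin_closed h_simps)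
      also have "\<dots> = mul (W u) (mul (W v') (f z))"
        using less.prems False by (subst zinbiel) (auto simp: v WA f)
      finally show ?thesis using False by (simp add: v Wsnoc)
    qed
  qed
  have hm: "h (a \<odot> b) = mul (h a) (h b)" if "a \<in> zin I" "b \<in> zin I" for a b
    using that(1)
  proof (induction a rule: zin_induct)
    case zero
    then show ?case using that by (simp add: zmul_simps h_simps mul_zero hA)
  next
    case (add k u a)
    have "h (word u \<odot> b) = mul (W u) (h b)" using that(2)
    proof (induction b rule: zin_induct)
      case zero
      then show ?case using add by (simp add: zmul_simps(1,2) h_simps mul_zero WA)
    next
      case (add k' v b)
      then show ?case using \<open>u \<noteq> []\<close> \<open>set u \<subseteq> I\<close>
        by (simp add: zmul_simps(3-6) h_simps hw mul_add_right mul_scale_right hA WA carrier_closed)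
    qed
    with add that(2) show ?case
      by (simp add: zmul_simps(3-6) h_simps mul_add_left mul_scale_left hA WA carrier_closed)
  qed
  have "alg_hom zscale (\<odot>) (zin I) scale mul A h"
    by (simp add: alg_hom_def hA hm h_simps)
  moreover have "\<forall>i\<in>I. h (gen i) = f i" by (simp add: gen_def h_simps W1)
  ultimately show ?thesis by blast
qed

theorem zin_universal_uniqueness:
  fixes scale :: "'k::field_char_0 \<Rightarrow> 'b::ab_group_add \<Rightarrow> 'b" and I :: "'i set"
  assumes "zinbiel_algebra scale mul A"
    and g: "alg_hom zscale (\<odot>) (zin I) scale mul A g"
    and h: "alg_hom zscale (\<odot>) (zin I) scale mul A h"
    and eq: "\<forall>i\<in>I. g (gen i) = h (gen i)"
    and "a \<in> zin I"
  shows "g a = h a"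
proof -
  interpret zinbiel_algebra scale mul A by fact
  have w: "g (word w) = h (word w)" if "w \<noteq> []" "set w \<subseteq> I" for w
    using that
  proof (induction w rule: rev_nonempty_induct)
    case (single x) then show ?case using eq by (simp add: gen_def)
  next
    case (snoc x xs)
    have "(word (xs @ [x]) :: ('i, 'k) zin) = word xs \<odot> word [x]"
      by (simp add: word_gen app_simps)
    then show ?case using snoc g h eq by (simp add: alg_hom_def gen_def)
  qed
  have z: "g 0 = 0" "h 0 = 0"
  proof -
    have 0: "0 \<in> zin I" by (rule zin.subspace_0[OF subspace_zin])
    have "\<forall>k. \<forall>a\<in>zin I. g (zscale k a) = scale k (g a)" "\<forall>k. \<forall>a\<in>zin I. h (zscale k a) = scale k (h a)"
      using g h by (simp_all add: alg_hom_def)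
    from this[THEN spec, THEN bspec, OF 0, of 0] show "g 0 = 0" "h 0 = 0" by simp_all
  qed
  from \<open>a \<in> zin I\<close> show ?thesis
  proof (induction a rule: zin_induct)
    case (add k u a)
    have "g (zscale k (word u) + a) = scale k (g (word u)) + g a"
         "h (zscale k (word u) + a) = scale k (h (word u)) + h a"
      using g h add by (simp_all add: alg_hom_def zin_closed)
    with add w show ?case by simp
  qed (simp add: z)
qed


section \<open>The free special Tortkara algebra\<close>

definition bracket :: "('i, 'k::field_char_0) zin \<Rightarrow> ('i, 'k) zin \<Rightarrow> ('i, 'k) zin" where
  "bracket a b = a \<odot> b - b \<odot> a"

definition ST :: "'i set \<Rightarrow> ('i, 'k::field_char_0) zin set" where
  "ST I = \<Inter>{S. S \<subseteq> zin I \<and> zin.subspace S \<and> (\<forall>a\<in>S. \<forall>b\<in>S. bracket a b \<in> S) \<and> gen ` I \<subseteq> S}"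

definition ST_hom :: "'i set \<Rightarrow> ('i \<Rightarrow> nat) \<Rightarrow> ('i, 'k::field_char_0) zin set" where
  "ST_hom I m = {a \<in> ST I. \<forall>w\<in>Poly_Mapping.keys a. \<forall>i\<in>I. count_list w i = m i}"

definition ST_ge2 :: "'i set \<Rightarrow> ('i, 'k::field_char_0) zin set" where
  "ST_ge2 I = {a \<in> ST I. \<forall>w\<in>Poly_Mapping.keys a. 2 \<le> length w}"


section \<open>Skew-right-commutative elements\<close>

fun swap_last2 :: "'i list \<Rightarrow> 'i list" where
  "swap_last2 [] = []"
| "swap_last2 [x] = [x]"
| "swap_last2 [y, z] = [z, y]"
| "swap_last2 (x # y # z # w) = x # swap_last2 (y # z # w)"

definition p_map :: "('i, 'k::field_char_0) zin \<Rightarrow> ('i, 'k) zin" where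
  "p_map = lin zscale (\<lambda>w. if length w = 1 then - lbr w else lbr (swap_last2 w))"

definition overline :: "('i, 'k::field_char_0) zin \<Rightarrow> ('i, 'k) zin" where
  "overline a = a - p_map a"

definition Gamma :: "'i::linorder set \<Rightarrow> 'i list set" where
  "Gamma I = {\<alpha>. set \<alpha> \<subseteq> I \<and> length \<alpha> > 1 \<and> \<alpha> ! (length \<alpha> - 2) < \<alpha> ! (length \<alpha> - 1)}"

lemma swap_last2_append: "swap_last2 (w @ [y, z]) = w @ [z, y]"
proof (induction w)
  case (Cons x w)
  then show ?case by (cases w; cases "tl w") auto
qed simp

lemma p_gen: "p_map (gen i) = - gen i"
  by (simp add: p_map_def gen_def zlin_simps lbr_eq_word)

lemma p_lbr: "p_map (lbr (w @ [y, z])) = lbr (w @ [z, y])"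
  by (simp add: p_map_def lbr_eq_word zlin_simps swap_last2_append)

lemma p_linear: "p_map (a + b) = p_map a + p_map b" "p_map (zscale k a) = zscale k (p_map a)"
  by (simp_all add: p_map_def zlin_simps)

lemma overline_lbr: "overline (lbr (w @ [y, z])) = lbr (w @ [y, z]) - lbr (w @ [z, y])"
  by (simp add: overline_def p_lbr)


section \<open>Bases indexed by a family\<close>

definition basis_family :: "('j \<Rightarrow> ('i, 'k::field_char_0) zin) \<Rightarrow> 'j set \<Rightarrow> ('i, 'k) zin set \<Rightarrow> bool" where
  "basis_family b J V \<longleftrightarrow> inj_on b J \<and> zin.independent (b ` J) \<and> zin.span (b ` J) = V"

text \<open>\<open>zin.dim\<close> is \<open>0\<close> on infinite-dimensional spaces, so finiteness of the dimension is
  stated separately.\<close>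

definition fin_dim :: "('i, 'k::field_char_0) zin set \<Rightarrow> bool" where
  "fin_dim V \<longleftrightarrow> (\<exists>B. finite B \<and> zin.span B = V)"

end

theory Submission
  imports Defs "HOL-Combinatorics.Multiset_Permutations"
begin

text \<open>Write \<open>\<star>\<close> for the shuffle product and \<open>skew y z a\<close> for \<open>ayz - azy\<close>. Explicit formulas for
  the brackets of such elements show that, together with the generators, they span a subalgebra
  containing \<open>ST(X)\<close>. Conversely, modulo \<open>ST(X)\<close> the formula for \<open>[skew y z a, t]\<close> gives
  \<open>2 skew y z (at) = skew z t (y \<star> a) + skew t y (z \<star> a) - skew y z (t \<star> a)\<close> if all
  \<open>skew _ _ a\<close> are in \<open>ST(X)\<close>. Hence it suffices to treat prefixes of the form
  \<open>t\<^sub>1 \<star> \<dots> \<star> t\<^sub>k \<star> u\<close> with \<open>k > 0\<close>. By induction on the length of the word \<open>u\<close>, for a fixed collection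
  \<open>L\<close> of \<open>k + 2\<close> letters, the elements \<open>f(y, z)\<close>, in which \<open>y\<close> and \<open>z\<close> are the two last letters
  and the other letters of \<open>L\<close> are shuffled into \<open>u\<close>, satisfy an antisymmetric linear system
  modulo \<open>ST(X)\<close> that has only the zero solution in characteristic 0.\<close>

section \<open>The shuffle product\<close>

abbreviation shuffle_prod :: "('i, 'k::field_char_0) zin \<Rightarrow> ('i, 'k) zin \<Rightarrow> ('i, 'k) zin"  (infixl "\<star>" 70)
  where "a \<star> b \<equiv> bil shw a b"

lemma shuffle_assoc:
  fixes a b c :: "('i, 'k::field_char_0) zin"
  shows "a \<star> b \<star> c = a \<star> (b \<star> c)"
proof -
  note simps = bil_simps(1-6)[of shw]
  have 1: "word u \<star> word v \<star> c = word u \<star> (word v \<star> c)" for u v and c :: "('i, 'k) zin"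
    by (induction c rule: word_induct) (simp_all only: simps shm_assoc_word)
  have 2: "word u \<star> b \<star> c = word u \<star> (b \<star> c)" for u and b c :: "('i, 'k) zin"
    by (induction b rule: word_induct) (simp_all only: simps 1)
  show ?thesis
    by (induction a rule: word_induct) (simp_all only: simps 2)
qed

text \<open>With commutativity and the empty word as unit, shuffle products over finite index sets
  become available as \<open>shuffle_prod_set\<close>.\<close>

global_interpretation shuffle: comm_monoid_set "bil shw" "word [] :: ('i, 'k::field_char_0) zin"
  defines shuffle_prod_set = shuffle.F
  by unfold_locales (auto simp: shuffle_assoc shm_Nil shm_commute[of _ "word []"] intro: shm_commute)

lemma bil_diff:
  "bil F (a - a') b = bil F a b - bil F a' b" "bil F a (b - b') = bil F a b - bil F a b'"
  using bil_simps(3)[of F "a - a'" a' b] bil_simps(4)[of F a "b - b'" b']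
  by (simp_all add: algebra_simps)

lemma app_diff: "app z (a - b) = app z a - app z b"
  using app_simps(2)[of z "a - b" b] by (simp add: algebra_simps)

lemma app_sum: "app z (sum f A) = (\<Sum>x\<in>A. app z (f x))"
  by (induction A rule: infinite_finite_induct) (simp_all add: app_simps)

lemma shuffle_letter_app: "word [t] \<star> app s b = app t (app s b) + app s (word [t] \<star> b)"
  using shm_app[of "[]" t s b] by (simp add: shm_Nil)

text \<open>The last letter of a shuffle is the last letter of one of the two factors; each summand
  collects one case.\<close>

lemma shuffle_app_app: "app x a \<star> app y b = app x (a \<star> app y b) + app y (app x a \<star> b)"
proof (induction a rule: word_induct)
  case (2 k u a)
  then show ?case by (simp add: bil_simps(1-6) app_simps shm_app algebra_simps)
qed (simp add: bil_simps app_simps)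

text \<open>The half-shuffle keeps the last letter of the right factor in place and shuffles
  everything before it with the left factor.\<close>

lemma zmul_app_right: "a \<odot> app z b = app z (a \<star> b)"
  by (induction a rule: word_induct) (simp_all add: bil_simps(1-6) app_simps zmul_simps(1-6) zmul_app)


section \<open>Linear combinations of words over an alphabet\<close>

text \<open>Unlike \<open>zin I\<close>, this space contains the empty word: it holds the prefixes
  in front of the last two letters, and these may be empty.\<close>

definition words_space :: "'i set \<Rightarrow> ('i, 'k::field_char_0) zin set" where
  "words_space I = zin.span (word ` {w. set w \<subseteq> I})"

definition words_space_deg :: "'i set \<Rightarrow> nat \<Rightarrow> ('i, 'k::field_char_0) zin set" where
  "words_space_deg I n = zin.span (word ` {w. set w \<subseteq> I \<and> length w = n})"

lemma app_linear: "module_hom zscale zscale (app z)"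
  by unfold_locales (simp_all add: app_simps)

lemma bil_linear_right: "module_hom zscale zscale (bil F a)"
  by unfold_locales (simp_all add: bil_simps)

lemma bil_linear_left: "module_hom zscale zscale (\<lambda>a. bil F a b)"
  by unfold_locales (simp_all add: bil_simps)

text \<open>Extension by linearity: membership of images has to be checked on a spanning set
  only.\<close>

lemma span_image_induct:
  assumes "a \<in> zin.span B" "module_hom zscale zscale f" "zin.subspace S" "\<And>b. b \<in> B \<Longrightarrow> f b \<in> S"
  shows "f a \<in> S"
proof -
  interpret module_hom zscale zscale f by fact
  show ?thesis
    using assms(1)
    by (induction rule: zin.span_induct_alt)
      (auto simp: add scale zero assms intro!: zin.subspace_add[OF assms(3)] zin.subspace_scale[OF assms(3)]
         zin.subspace_0[OF assms(3)])
qed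

lemma app_words_space: "a \<in> words_space I \<Longrightarrow> z \<in> I \<Longrightarrow> app z a \<in> words_space I"
  unfolding words_space_def
  by (erule span_image_induct[OF _ app_linear zin.subspace_span])
    (auto simp: app_simps intro!: zin.span_base)

lemma app_words_space_deg: "a \<in> words_space_deg I n \<Longrightarrow> z \<in> I \<Longrightarrow> app z a \<in> words_space_deg I (Suc n)"
  unfolding words_space_deg_def
  by (erule span_image_induct[OF _ app_linear zin.subspace_span])
    (auto simp: app_simps intro!: zin.span_base)

lemma word_words_space: "set w \<subseteq> I \<Longrightarrow> word w \<in> words_space I"
  by (auto simp: words_space_def intro!: zin.span_base)

lemma word_words_space_deg: "set w \<subseteq> I \<Longrightarrow> length w = n \<Longrightarrow> word w \<in> words_space_deg I n"
  by (auto simp: words_space_deg_def intro!: zin.span_base)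

lemma shuffle_words_space:
  assumes "a \<in> words_space I" "b \<in> words_space I" shows "a \<star> b \<in> words_space I"
proof -
  have w: "shw u v \<in> words_space I" if "set u \<subseteq> I" "set v \<subseteq> I" for u v
  proof -
    have "(\<Sum>w\<leftarrow>ws. word w) \<in> words_space I" if "\<forall>w\<in>set ws. set w \<subseteq> I" for ws
      using that
      by (induction ws) (simp_all add: words_space_def zin.span_zero zin.span_add zin.span_base)
    moreover have "\<forall>w\<in>set (shuffle_list u v). set w \<subseteq> I"
      using set_shuffle_list[of _ u v] that by blast
    ultimately show ?thesis by (simp add: shw_def)
  qed
  have "word u \<star> b \<in> words_space I" if "set u \<subseteq> I" for u
    using assms(2) unfolding words_space_def
    by (rule span_image_induct[OF _ bil_linear_right zin.subspace_span])
      (use w that in \<open>auto simp: bil_simps words_space_def\<close>)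
  then show ?thesis
    using span_image_induct[OF _ bil_linear_left zin.subspace_span, of a "word ` {w. set w \<subseteq> I}" shw b]
      assms(1) unfolding words_space_def by blast
qed

text \<open>Length is tracked for shuffles with a single letter; longer shuffles of letters are
  built from these one at a time.\<close>

lemma shuffle_letter_words_space_deg:
  fixes a :: "('i, 'k::field_char_0) zin"
  assumes "a \<in> words_space_deg I n" "t \<in> I"
  shows "word [t] \<star> a \<in> words_space_deg I (Suc n)"
proof -
  have "word [t] \<star> word w \<in> (words_space_deg I (Suc (length w)) :: ('i, 'k) zin set)" if "set w \<subseteq> I" for w
    using that
  proof (induction w rule: rev_induct)
    case Nil
    then show ?case using assms(2) by (auto simp: bil_simps shw_simps intro: word_words_space_deg)
  next
    case (snoc x w)
    have "word [t] \<star> word (w @ [x]) = app t (word (w @ [x])) + app x (word [t] \<star> word w :: ('i, 'k) zin)"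
      using shuffle_letter_app[of t x "word w"] by (simp add: app_simps)
    moreover have "app t (word (w @ [x])) \<in> (words_space_deg I (Suc (length (w @ [x]))) :: ('i, 'k) zin set)"
      "app x (word [t] \<star> word w) \<in> (words_space_deg I (Suc (length (w @ [x]))) :: ('i, 'k) zin set)"
      using snoc assms(2) by (auto intro!: app_words_space_deg word_words_space_deg)
    ultimately show ?case unfolding words_space_deg_def by (simp only: zin.span_add)
  qed
  then have "word [t] \<star> b \<in> (words_space_deg I (Suc n) :: ('i, 'k) zin set)"
    if "b \<in> word ` {w. set w \<subseteq> I \<and> length w = n}" for b
    using that by auto
  with assms(1) show ?thesis
    unfolding words_space_deg_def
    by (rule span_image_induct[OF _ bil_linear_right zin.subspace_span])
qed


section \<open>Skew-right-commutative elements\<close>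

text \<open>Allowing an arbitrary combination of words as prefix, not only a word, makes shuffles
  possible as prefixes.\<close>

definition skew :: "'i \<Rightarrow> 'i \<Rightarrow> ('i, 'k::field_char_0) zin \<Rightarrow> ('i, 'k) zin" where
  "skew y z a = app z (app y a) - app y (app z a)"

lemma skew_simps: "skew y z 0 = 0" "skew y z (a + b) = skew y z a + skew y z b"
  "skew y z (zscale k a) = zscale k (skew y z a)" "skew y z (a - b) = skew y z a - skew y z b"
  by (simp_all add: skew_def app_simps app_diff zin.scale_right_diff_distrib)

lemma skew_word: "skew y z (word u) = word (u @ [y, z]) - word (u @ [z, y])"
  by (simp add: skew_def app_simps)

lemma skew_sum: "skew y z (sum f A) = (\<Sum>x\<in>A. skew y z (f x))"
  by (induction A rule: infinite_finite_induct) (simp_all add: skew_simps)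

lemma skew_same [simp]: "skew y y a = 0"
  by (simp add: skew_def)

lemma skew_swap: "skew z y a = - skew y z a"
  by (simp add: skew_def)

lemma skew_linear: "module_hom zscale zscale (skew y z)"
  by unfold_locales (simp_all add: skew_simps)

section \<open>Brackets of generators and skew elements\<close>

lemma bracket_swap: "bracket b a = - bracket a b"
  by (simp add: bracket_def)

lemma bracket_simps:
  "bracket 0 b = 0" "bracket a 0 = 0"
  "bracket (a + a') b = bracket a b + bracket a' b"
  "bracket a (b + b') = bracket a b + bracket a b'"
  "bracket (zscale k a) b = zscale k (bracket a b)"
  "bracket a (zscale k b) = zscale k (bracket a b)"
  by (simp_all add: bracket_def zmul_simps zin.scale_right_diff_distrib)

lemma bracket_linear_left: "module_hom zscale zscale (\<lambda>a. bracket a b)"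
  and bracket_linear_right: "module_hom zscale zscale (bracket a)"
  by (unfold_locales, simp_all add: bracket_simps)+

lemma bracket_gen_gen: "bracket (gen y) (gen z) = skew y z (word [])"
  by (simp add: bracket_def gen_def word_gen app_simps skew_def)

text \<open>Multiplying by \<open>t\<close> on the right appends it. In the opposite product the
  letter next to the last is either \<open>t\<close> or the old one. The terms then pair up into
  differences of words with swapped last letters.\<close>

lemma bracket_skew_gen:
  "bracket (skew y z a) (gen t) = skew z t (app y a) + skew t y (app z a) - skew y z (word [t] \<star> a)"
proof -
  have "word [t] \<odot> skew y z a =
      app z (app t (app y a)) + app z (app y (word [t] \<star> a))
      - (app y (app t (app z a)) + app y (app z (word [t] \<star> a)))"
    by (simp add: skew_def zmul_bil bil_diff)
      (simp add: zmul_bil[symmetric] zmul_app_right shuffle_letter_app app_simps)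
  then show ?thesis
    by (simp add: bracket_def gen_def word_gen skew_def app_diff)
qed

text \<open>In each product the last letter is fixed, and the letter before it comes from either
  factor. Words whose last two letters come from the same factor give the first two terms; the mixed
  ones of both orders combine into the other four.\<close>

lemma bracket_skew_skew:
  "bracket (skew y z a) (skew s t b) =
     skew s t (skew y z a \<star> b) - skew y z (a \<star> skew s t b)
     + skew z t (app y a \<star> app s b) - skew z s (app y a \<star> app t b)
     - skew y t (app z a \<star> app s b) + skew y s (app z a \<star> app t b)"
proof -
  have *: "app z (app y a) \<odot> app t (app s b) =
      app t (app s (app z (app y a) \<star> b)) + app t (app z (app y a \<star> app s b))" 
    for y z s t and a b :: "('a, 'b) zin"
    by (simp add: zmul_app_right shuffle_app_app app_simps)
  \<comment> \<open>The same identity with the shuffles commuted: used for the opposite order of the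
    product, it makes the mixed prefixes agree literally.\<close>
  have **: "app z (app y a) \<odot> app t (app s b) =
      app t (app s (b \<star> app z (app y a))) + app t (app z (app s b \<star> app y a))" 
    for y z s t and a b :: "('a, 'b) zin"
    unfolding * by (simp add: shm_commute)
  show ?thesis
    unfolding bracket_def skew_def zmul_bil bil_diff
    unfolding zmul_bil[symmetric] *[of z y a] **[of t s b] *[of y z a] **[of s t b]
    by (simp add: bil_diff app_diff algebra_simps)
qed


section \<open>Skew-right-commutative elements generate\<close>

lemma subspace_ST: "zin.subspace (ST I :: ('i, 'k::field_char_0) zin set)"
  unfolding ST_def by (rule zin.subspace_Inter) blast

lemma bracket_ST: "a \<in> ST I \<Longrightarrow> b \<in> ST I \<Longrightarrow> bracket a b \<in> ST I"
  unfolding ST_def by blast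

lemma gen_ST: "i \<in> I \<Longrightarrow> gen i \<in> ST I"
  unfolding ST_def by blast

lemmas ST_closed = zin.subspace_add[OF subspace_ST] zin.subspace_diff[OF subspace_ST]
  zin.subspace_scale[OF subspace_ST] zin.subspace_0[OF subspace_ST] zin.subspace_sum[OF subspace_ST]

section \<open>Antisymmetric linear systems modulo a subspace\<close>

lemma zin_eq_minus_self_iff: "a = - a \<longleftrightarrow> a = (0 :: ('i, 'k::field_char_0) zin)"
proof
  assume "a = - a"
  then have "Poly_Mapping.lookup a w = - Poly_Mapping.lookup a w" for w
    by (metis lookup_uminus)
  then show "a = 0" by (intro poly_mapping_eqI) simp
qed simp

lemma subspace_scale_cancel:
  assumes "zin.subspace S" "k \<noteq> 0" "zscale k a \<in> S" shows "a \<in> S"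
  using zin.subspace_scale[OF assms(1,3), of "inverse k"] assms(2) by simp

text \<open>Summing the hypothesis over \<open>j\<close> isolates the row sum of \<open>i\<close>, since by antisymmetry
  all row sums add up to 0.\<close>
lemma antisym_family_in_subspace:
  fixes f :: "'j \<Rightarrow> 'j \<Rightarrow> ('i, 'k::field_char_0) zin"
  assumes S: "zin.subspace S" and L: "finite L" and k: "k > 0"
    and anti: "\<And>i j. f j i = - f i j"
    and rel: "\<And>i j. i \<in> L \<Longrightarrow> j \<in> L \<Longrightarrow> i \<noteq> j \<Longrightarrow>
      zscale (of_nat k) (f i j) + (\<Sum>l\<in>L. f i l) - (\<Sum>l\<in>L. f j l) \<in> S"
    and ij: "i \<in> L" "j \<in> L"
  shows "f i j \<in> S"
proof -
  define g where "g i = (\<Sum>l\<in>L. f i l)" for i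
  have f0: "f i i = 0" for i using anti[of i i] zin_eq_minus_self_iff by blast
  \<comment> \<open>On the diagonal the relation is trivial because \<open>f i i = 0\<close>, so it
    may be summed over all of \<open>L\<close>.\<close>
  have rel': "zscale (of_nat k) (f i j) + g i - g j \<in> S" if "i \<in> L" "j \<in> L" for i j
    using rel[OF that] by (cases "i = j") (simp_all add: g_def f0 zin.subspace_0[OF S])
  have "(\<Sum>i\<in>L. g i) = (\<Sum>i\<in>L. \<Sum>j\<in>L. f j i)"
    unfolding g_def by (rule sum.swap)
  also have "\<dots> = (\<Sum>i\<in>L. \<Sum>j\<in>L. - f i j)"
    by (intro sum.cong refl anti)
  also have "\<dots> = - (\<Sum>i\<in>L. g i)"
    by (simp add: g_def sum_negf)
  finally have sum_g: "(\<Sum>i\<in>L. g i) = 0" using zin_eq_minus_self_iff by blast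
  have g: "g i \<in> S" if "i \<in> L" for i
  proof -
    have "(\<Sum>j\<in>L. zscale (of_nat k) (f i j) + g i - g j) \<in> S"
      using rel'[OF that] by (intro zin.subspace_sum[OF S]) auto
    \<comment> \<open>The first term contributes \<open>k\<close> copies of \<open>g i\<close>, the
      constant term \<open>card L\<close> copies. The total is nonzero in characteristic 0 since
      \<open>k > 0\<close>.\<close>
    also have "(\<Sum>j\<in>L. zscale (of_nat k) (f i j) + g i - g j) = zscale (of_nat (k + card L)) (g i)"
      by (simp add: sum.distrib sum_subtractf sum_g zin.sum_constant_scale zin.scale_left_distrib
        zin.scale_sum_right[symmetric]) (simp add: g_def)
    finally show ?thesis
      by (rule subspace_scale_cancel[OF S, rotated]) (use k in \<open>simp del: of_nat_add\<close>)
  qed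
  have "zscale (of_nat k) (f i j) = (zscale (of_nat k) (f i j) + g i - g j) - g i + g j" by simp
  also have "\<dots> \<in> S"
    by (rule zin.subspace_add[OF S zin.subspace_diff[OF S rel'[OF ij] g[OF ij(1)]] g[OF ij(2)]])
  finally show ?thesis
    by (rule subspace_scale_cancel[OF S, rotated]) (use k in simp)
qed

text \<open>The letters are indexed by \<open>J\<close> so that a repeated letter counts as often as
  it occurs.\<close>

definition shuffle_letters :: "('j \<Rightarrow> 'i) \<Rightarrow> 'j set \<Rightarrow> ('i, 'k::field_char_0) zin" where
  "shuffle_letters t J = shuffle_prod_set (\<lambda>j. word [t j]) J"

lemma shuffle_letters_empty [simp]: "shuffle_letters t {} = word []"
  by (simp add: shuffle_letters_def)

lemma shuffle_letters_insert:
  "finite J \<Longrightarrow> j \<notin> J \<Longrightarrow> shuffle_letters t (insert j J) = word [t j] \<star> shuffle_letters t J"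
  by (simp add: shuffle_letters_def)

lemma shuffle_letters_cong:
  "(\<And>j. j \<in> J \<Longrightarrow> t j = t' j) \<Longrightarrow> shuffle_letters t J = shuffle_letters t' J"
  unfolding shuffle_letters_def by (rule shuffle.cong) auto

lemma shuffle_letters_words_space_deg:
  assumes "finite J" "t ` J \<subseteq> I" "a \<in> words_space_deg I n"
  shows "shuffle_letters t J \<star> a \<in> words_space_deg I (card J + n)"
  using assms(1,2)
proof (induction J rule: finite_induct)
  case empty
  then show ?case using assms(3) by (simp add: shm_Nil)
next
  case (insert j J)
  then have "word [t j] \<star> (shuffle_letters t J \<star> a) \<in> words_space_deg I (Suc (card J + n))"
    by (intro shuffle_letter_words_space_deg) auto
  then show ?case using insert by (simp add: shuffle_letters_insert shuffle_assoc)
qed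

text \<open>Sorting by the last letter: it is either \<open>s\<close> or one of the shuffled letters
  \<open>t j\<close>, which then leaves the index set.\<close>

lemma shuffle_letters_app:
  fixes t :: "'j \<Rightarrow> 'i" and u :: "('i, 'k::field_char_0) zin"
  assumes "finite J"
  shows "shuffle_letters t J \<star> app s u =
    app s (shuffle_letters t J \<star> u) + (\<Sum>j\<in>J. app (t j) (shuffle_letters t (J - {j}) \<star> app s u))"
  using assms
proof (induction J rule: finite_induct)
  case empty
  then show ?case by (simp add: shm_Nil)
next
  case (insert x J)
  let ?T = "shuffle_letters t :: 'j set \<Rightarrow> ('i, 'k) zin"
  have *: "?T (insert x J - {j}) = word [t x] \<star> ?T (J - {j})" if "j \<in> J" for j
  proof -
    have "insert x J - {j} = insert x (J - {j})" using that insert.hyps by auto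
    then show ?thesis using insert.hyps by (simp add: shuffle_letters_insert)
  qed
  have "?T (insert x J) \<star> app s u = word [t x] \<star> (?T J \<star> app s u)"
    using insert by (simp add: shuffle_letters_insert shuffle_assoc)
  also have "\<dots> = app (t x) (?T J \<star> app s u) + app s (word [t x] \<star> (?T J \<star> u))
      + (\<Sum>j\<in>J. app (t j) (word [t x] \<star> (?T (J - {j}) \<star> app s u)))"
    unfolding insert.IH bil_simps(4) module_hom.sum[OF bil_linear_right] shuffle_letter_app
      sum.distrib app_simps(2) app_sum
    by (simp only: add_ac)
  also have "\<dots> = app s (?T (insert x J) \<star> u) +
      (\<Sum>j\<in>insert x J. app (t j) (?T (insert x J - {j}) \<star> app s u))"
    using insert.hyps by (simp add: shuffle_letters_insert shuffle_assoc * add_ac)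
  finally show ?case .
qed

text \<open>The analogue for an empty second factor. For empty \<open>J\<close> it fails, as the sum
  would be 0 instead of the empty word.\<close>

lemma shuffle_letters_expand:
  fixes t :: "'j \<Rightarrow> 'i"
  assumes "finite J" "J \<noteq> {}"
  shows "(shuffle_letters t J :: ('i, 'k::field_char_0) zin) =
    (\<Sum>j\<in>J. app (t j) (shuffle_letters t (J - {j})))"
  using assms
proof (induction J rule: finite_ne_induct)
  case (singleton x)
  then show ?case by (simp add: shuffle_letters_insert bil_simps shw_simps app_simps)
next
  case (insert x J)
  let ?T = "shuffle_letters t :: 'j set \<Rightarrow> ('i, 'k) zin"
  have *: "?T (insert x J - {j}) = word [t x] \<star> ?T (J - {j})" if "j \<in> J" for j
  proof -
    have "insert x J - {j} = insert x (J - {j})" using that insert.hyps by auto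
    then show ?thesis using insert.hyps by (simp add: shuffle_letters_insert)
  qed
  have "?T (insert x J) = word [t x] \<star> (\<Sum>j\<in>J. app (t j) (?T (J - {j})))"
    using insert by (simp add: shuffle_letters_insert)
  also have "\<dots> = app (t x) (\<Sum>j\<in>J. app (t j) (?T (J - {j})))
      + (\<Sum>j\<in>J. app (t j) (word [t x] \<star> ?T (J - {j})))"
    unfolding module_hom.sum[OF bil_linear_right] shuffle_letter_app sum.distrib app_sum ..
  also have "\<dots> = (\<Sum>j\<in>insert x J. app (t j) (?T (insert x J - {j})))"
    using insert.hyps by (simp add: * insert.IH[symmetric])
  finally show ?case .
qed

text \<open>The identity for \<open>[skew y z a, t]\<close> and its two cyclic rotations are three linear equations,
  which are solved for \<open>skew y z (app t a)\<close>.\<close>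
lemma skew_app_mod_ST:
  assumes a: "\<And>y z. y \<in> I \<Longrightarrow> z \<in> I \<Longrightarrow> skew y z a \<in> ST I"
    and I: "y \<in> I" "z \<in> I" "t \<in> I"
  shows "zscale 2 (skew y z (app t a)) -
    (skew z t (word [y] \<star> a) + skew t y (word [z] \<star> a) - skew y z (word [t] \<star> a)) \<in> ST I"
proof -
  have "bracket (skew z t a) (gen y) + bracket (skew t y a) (gen z) - bracket (skew y z a) (gen t) \<in> ST I"
    using a I by (intro ST_closed bracket_ST gen_ST) auto
  also have "zscale 2 c = c + c" for c :: "('a, 'b) zin"
    by (rule poly_mapping_eqI) (simp add: lookup_add)
  then have "bracket (skew z t a) (gen y) + bracket (skew t y a) (gen z) - bracket (skew y z a) (gen t) =
    zscale 2 (skew y z (app t a)) -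
    (skew z t (word [y] \<star> a) + skew t y (word [z] \<star> a) - skew y z (word [t] \<star> a))"
    by (simp add: bracket_skew_gen algebra_simps)
  finally show ?thesis .
qed

text \<open>By \<open>card L + m = n + 3\<close> the prefix for distinct \<open>i\<close>,
  \<open>j\<close> has degree \<open>n + 1\<close>, one more than \<open>IH\<close> covers. Sorting
  it by last letter as in \<open>expand\<close> and applying \<open>skew_app_mod_ST\<close> to the
  summands ending in \<open>t l\<close> relates the skew elements for different pairs
  \<open>i\<close>, \<open>j\<close>. The remainder \<open>x\<close> holds the words that do not end
  in a shuffled letter.\<close>

lemma skew_shuffle_letters_step:
  fixes t :: "'j \<Rightarrow> 'i" and b :: "('i, 'k::field_char_0) zin"
  assumes IH: "\<And>a y z. (a :: ('i, 'k) zin) \<in> words_space_deg I n \<Longrightarrow>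
      y \<in> I \<Longrightarrow> z \<in> I \<Longrightarrow> skew y z a \<in> ST I"
    and b: "b \<in> words_space_deg I m"
    and L: "finite L" "card L + m = n + 3" "3 \<le> card L" "t ` L \<subseteq> I"
    and ij: "i \<in> L" "j \<in> L"
    and expand: "\<And>i j. i \<in> L \<Longrightarrow> j \<in> L \<Longrightarrow> i \<noteq> j \<Longrightarrow>
      \<exists>x. shuffle_letters t (L - {i, j}) \<star> b =
        x + (\<Sum>l\<in>L - {i, j}. app (t l) (shuffle_letters t (L - {i, j} - {l}) \<star> b)) \<and>
      skew (t i) (t j) x \<in> ST I"
  shows "skew (t i) (t j) (shuffle_letters t (L - {i, j}) \<star> b) \<in> ST I"
proof -
  define f where "f i j = skew (t i) (t j) (shuffle_letters t (L - {i, j}) \<star> b)" for i j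
  define k where "k = card L - 2"
  have anti: "f j i = - f i j" for i j
    unfolding f_def by (simp add: skew_swap[of "t i"] insert_commute)
  have f0: "f i i = 0" for i by (simp add: f_def)
  have "f i j \<in> ST I"
  proof (rule antisym_family_in_subspace[OF subspace_ST L(1) _ anti _ ij])
    show "0 < k" using L(3) by (simp add: k_def)
  next
    fix i j assume ij: "i \<in> L" "j \<in> L" "i \<noteq> j"
    let ?J = "L - {i, j}"
    have t: "t l \<in> I" if "l \<in> L" for l using that L(4) by auto
    have cardJ: "card ?J = k" using ij L(1) by (simp add: k_def card_Diff_subset)
    obtain x where x: "shuffle_letters t ?J \<star> b =
        x + (\<Sum>l\<in>?J. app (t l) (shuffle_letters t (?J - {l}) \<star> b))"
      and xST: "skew (t i) (t j) x \<in> ST I"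
      using expand[OF ij] by blast
    \<comment> \<open>Removing \<open>l\<close> from the prefix brings it down to degree
      \<open>n\<close>. Shuffling \<open>i\<close>, \<open>j\<close> or \<open>l\<close> back in
      gives the complement of \<open>{j, l}\<close>, \<open>{l, i}\<close> or \<open>{i, j}\<close>,
      so the right-hand side consists of values of \<open>f\<close> again.\<close>
    have "zscale 2 (skew (t i) (t j) (app (t l) (shuffle_letters t (?J - {l}) \<star> b)))
        - (f j l + f l i - f i j) \<in> ST I" if l: "l \<in> ?J" for l
    proof -
      let ?a = "shuffle_letters t (?J - {l}) \<star> b"
      have "card (?J - {l}) + m = n"
        using l L cardJ by (simp add: k_def)
      moreover have "shuffle_letters t (?J - {l}) \<star> b \<in> words_space_deg I (card (?J - {l}) + m)"
        using t L(1) by (intro shuffle_letters_words_space_deg b) auto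
      ultimately have a: "?a \<in> words_space_deg I n" by simp
      have i: "insert i (?J - {l}) = L - {j, l}" and j: "insert j (?J - {l}) = L - {l, i}"
        and l': "insert l (?J - {l}) = ?J"
        using l ij by auto
      have *: "word [t x] \<star> ?a = shuffle_letters t (insert x (?J - {l})) \<star> b" if "x \<notin> ?J - {l}" for x
        using that L(1) by (simp add: shuffle_letters_insert shuffle_assoc)
      have "word [t i] \<star> ?a = shuffle_letters t (L - {j, l}) \<star> b"
        "word [t j] \<star> ?a = shuffle_letters t (L - {l, i}) \<star> b"
        "word [t l] \<star> ?a = shuffle_letters t ?J \<star> b"
        using *[of i] *[of j] *[of l] unfolding i j l' by auto
      moreover have "zscale 2 (skew (t i) (t j) (app (t l) ?a)) -
          (skew (t j) (t l) (word [t i] \<star> ?a) + skew (t l) (t i) (word [t j] \<star> ?a)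
           - skew (t i) (t j) (word [t l] \<star> ?a)) \<in> ST I"
        using l ij t by (intro skew_app_mod_ST IH[OF a]) auto
      ultimately show ?thesis by (simp add: f_def)
    qed
    then have "(\<Sum>l\<in>?J. zscale 2 (skew (t i) (t j) (app (t l) (shuffle_letters t (?J - {l}) \<star> b)))
        - (f j l + f l i - f i j)) + zscale 2 (skew (t i) (t j) x) \<in> ST I"
      using xST by (intro ST_closed(1,3,5)) auto
    also have "(\<Sum>l\<in>?J. zscale 2 (skew (t i) (t j) (app (t l) (shuffle_letters t (?J - {l}) \<star> b)))
        - (f j l + f l i - f i j)) + zscale 2 (skew (t i) (t j) x)
      = zscale 2 (f i j) - (\<Sum>l\<in>?J. f j l + f l i) + zscale (of_nat k) (f i j)"
    proof -
      have "f i j = skew (t i) (t j) x +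
          (\<Sum>l\<in>?J. skew (t i) (t j) (app (t l) (shuffle_letters t (?J - {l}) \<star> b)))"
        unfolding f_def by (subst x) (simp only: skew_simps skew_sum)
      moreover have "(\<Sum>l\<in>?J. f i j) = zscale (of_nat k) (f i j)"
        unfolding zin.sum_constant_scale cardJ ..
      ultimately show ?thesis
        by (simp add: sum_subtractf zin.scale_right_distrib zin.scale_sum_right sum.distrib)
    qed
    \<comment> \<open>The indices \<open>i\<close> and \<open>j\<close> contribute
      \<open>- f i j\<close> each, which cancels the coefficient 2 and leaves the form required by
      \<open>antisym_family_in_subspace\<close>.\<close>
    also have "(\<Sum>l\<in>?J. f j l + f l i) = (\<Sum>l\<in>L. f j l + f l i) + zscale 2 (f i j)"
    proof -
      have "(\<Sum>l\<in>L. f j l + f l i) = (\<Sum>l\<in>?J. f j l + f l i) + (\<Sum>l\<in>{i, j}. f j l + f l i)"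
        using ij L(1) by (intro sum.subset_diff) auto
      also have "(\<Sum>l\<in>{i, j}. f j l + f l i) = - zscale 2 (f i j)"
        using ij(3) zin.scale_left_distrib[of 1 1 "f i j"] by (simp add: f0 anti[of i j])
      finally show ?thesis by simp
    qed
    also have "(\<Sum>l\<in>L. f j l + f l i) = (\<Sum>l\<in>L. f j l) - (\<Sum>l\<in>L. f i l)"
      by (simp add: sum.distrib anti[of i] sum_negf)
    finally show "zscale (of_nat k) (f i j) + (\<Sum>l\<in>L. f i l) - (\<Sum>l\<in>L. f j l) \<in> ST I"
      by (simp add: algebra_simps)
  qed
  then show ?thesis by (simp add: f_def)
qed

text \<open>Induction on \<open>w\<close>, trading its last letter for one more index in
  \<open>L\<close> while the total degree stays fixed. Natural numbers serve as indices because a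
  fresh one always exists.\<close>

lemma skew_shuffle_letters_in_ST:
  fixes t :: "nat \<Rightarrow> 'i"
  assumes IH: "\<And>a y z. (a :: ('i, 'k::field_char_0) zin) \<in> words_space_deg I n \<Longrightarrow>
      y \<in> I \<Longrightarrow> z \<in> I \<Longrightarrow> skew y z a \<in> ST I"
    and "set w \<subseteq> I" "finite L" "card L + length w = n + 3" "3 \<le> card L" "t ` L \<subseteq> I"
      "i \<in> L" "j \<in> L"
  shows "skew (t i) (t j) (shuffle_letters t (L - {i, j}) \<star> word w) \<in> (ST I :: ('i, 'k) zin set)"
  using assms(2-)
proof (induction w arbitrary: L t i j rule: rev_induct)
  case Nil
  show ?case
  proof (rule skew_shuffle_letters_step[where n = n, OF IH word_words_space_deg[OF _ refl]])
    fix i j assume ij: "i \<in> L" "j \<in> L" "i \<noteq> j"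
    let ?J = "L - {i, j}"
    \<comment> \<open>Here \<open>3 \<le> card L\<close> enters: at least one letter is shuffled, so
      the expansion applies with remainder 0.\<close>
    have "card ?J \<noteq> 0" using ij Nil.prems by (simp add: card_Diff_subset)
    then have J: "finite ?J" "?J \<noteq> {}" using Nil.prems by auto
    show "\<exists>x. shuffle_letters t ?J \<star> word [] =
        x + (\<Sum>l\<in>?J. app (t l) (shuffle_letters t (?J - {l}) \<star> word [])) \<and>
      skew (t i) (t j) x \<in> ST I"
      using shuffle_letters_expand[OF J, of t]
      by (intro exI[of _ 0]) (simp add: skew_simps ST_closed shm_commute[of _ "word []"] shm_Nil)
  qed (use Nil.prems in auto)
next
  case snoc: (snoc s w)
  show ?case
  proof (rule skew_shuffle_letters_step[where n = n, OF IH word_words_space_deg[OF _ refl]])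
    fix i j assume ij: "i \<in> L" "j \<in> L" "i \<noteq> j"
    let ?J = "L - {i, j}"
    \<comment> \<open>The fresh index \<open>p\<close> carries the letter \<open>s\<close> split off
      from the word.\<close>
    obtain p where p: "p \<notin> L" using snoc.prems(2) ex_new_if_finite infinite_UNIV_nat by blast
    define t' where "t' = t(p := s)"
    let ?L = "insert p L"
    have t': "t' p = s" "\<And>l. l \<in> L \<Longrightarrow> t' l = t l" using p by (auto simp: t'_def)
    have t: "t l \<in> I" if "l \<in> L" for l using that snoc.prems(5) by auto
    have s: "s \<in> I" using snoc.prems by simp
    let ?a = "shuffle_letters t ?J \<star> word w :: ('i, 'k) zin"
    have ST: "skew (t' i') (t' j') (shuffle_letters t' (?L - {i', j'}) \<star> word w) \<in> (ST I :: ('i, 'k) zin set)"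
      if "i' \<in> ?L" "j' \<in> ?L" for i' j'
      using that p snoc.prems t' t s by (intro snoc.IH) auto
    have Ti: "word [t i] \<star> ?a = shuffle_letters t' (?L - {j, p}) \<star> word w"
    proof -
      have e: "?L - {j, p} = insert i ?J" using ij p by auto
      have "shuffle_letters t' (insert i ?J) = (shuffle_letters t (insert i ?J) :: ('i, 'k) zin)"
        using t' ij by (intro shuffle_letters_cong) auto
      then show ?thesis using snoc.prems(2) unfolding e by (simp add: shuffle_letters_insert shuffle_assoc)
    qed
    have Tj: "word [t j] \<star> ?a = shuffle_letters t' (?L - {p, i}) \<star> word w"
    proof -
      have e: "?L - {p, i} = insert j ?J" using ij p by auto
      have "shuffle_letters t' (insert j ?J) = (shuffle_letters t (insert j ?J) :: ('i, 'k) zin)"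
        using t' ij by (intro shuffle_letters_cong) auto
      then show ?thesis using snoc.prems(2) unfolding e by (simp add: shuffle_letters_insert shuffle_assoc)
    qed
    have Tp: "word [s] \<star> ?a = shuffle_letters t' (?L - {i, j}) \<star> word w"
    proof -
      have e: "?L - {i, j} = insert p ?J" using ij p by auto
      have "shuffle_letters t' ?J = (shuffle_letters t ?J :: ('i, 'k) zin)"
        using t' by (intro shuffle_letters_cong) auto
      then show ?thesis using snoc.prems(2) p t'(1) unfolding e by (simp add: shuffle_letters_insert shuffle_assoc)
    qed
    have "card ?J + length w = n" using ij snoc.prems by (simp add: card_Diff_subset)
    moreover have "?a \<in> words_space_deg I (card ?J + length w)"
      using t snoc.prems by (intro shuffle_letters_words_space_deg word_words_space_deg) auto
    ultimately have a: "?a \<in> words_space_deg I n" by simp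
    \<comment> \<open>The remainder is \<open>app s ?a\<close>, the words ending in
      \<open>s\<close>. The identity replaces appending \<open>s\<close> by shuffling one of
      \<open>t i\<close>, \<open>t j\<close>, \<open>s\<close> into \<open>?a\<close>, and the
      induction hypothesis for \<open>insert p L\<close> covers all three terms.\<close>
    have "zscale 2 (skew (t i) (t j) (app s ?a)) - (skew (t j) s (word [t i] \<star> ?a) +
        skew s (t i) (word [t j] \<star> ?a) - skew (t i) (t j) (word [s] \<star> ?a)) \<in> ST I"
      using t s ij by (intro skew_app_mod_ST IH[OF a]) auto
    moreover have "skew (t j) s (word [t i] \<star> ?a) +
        skew s (t i) (word [t j] \<star> ?a) - skew (t i) (t j) (word [s] \<star> ?a) \<in> ST I"
      unfolding Ti Tj Tp using ST[of j p] ST[of p i] ST[of i j] ij t'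
      by (intro ST_closed) auto
    ultimately have "zscale 2 (skew (t i) (t j) (app s ?a)) \<in> (ST I :: ('i, 'k) zin set)"
      using zin.subspace_add[OF subspace_ST] by fastforce
    then have "skew (t i) (t j) (app s ?a) \<in> ST I"
      by (rule subspace_scale_cancel[OF subspace_ST, rotated]) simp
    then show "\<exists>x. shuffle_letters t ?J \<star> word (w @ [s]) =
        x + (\<Sum>l\<in>?J. app (t l) (shuffle_letters t (?J - {l}) \<star> word (w @ [s]))) \<and>
      skew (t i) (t j) x \<in> (ST I :: ('i, 'k) zin set)"
      using shuffle_letters_app[of ?J t s "word w :: ('i, 'k) zin"] snoc.prems(2)
      by (intro exI[of _ "app s ?a"]) (simp add: app_simps)
  qed (use snoc.prems in auto)
qed

section \<open>Induction on the length of the prefix\<close>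

lemma skew_words_space_deg_induct:
  assumes "a \<in> words_space_deg I n" "zin.subspace S"
    "\<And>v. set v \<subseteq> I \<Longrightarrow> length v = n \<Longrightarrow> skew y z (word v) \<in> S"
  shows "skew y z a \<in> S"
  using assms(1) unfolding words_space_deg_def
  by (rule span_image_induct[OF _ skew_linear assms(2)]) (auto intro: assms(3))

text \<open>For a prefix \<open>w @ [s]\<close>, \<open>skew_app_mod_ST\<close> reduces the claim to
  prefixes in which a single letter is shuffled into \<open>w\<close>; these are the case of three
  indices in \<open>skew_shuffle_letters_in_ST\<close>.\<close>

lemma skew_in_ST:
  fixes a :: "('i, 'k::field_char_0) zin"
  assumes "a \<in> words_space_deg I n" "y \<in> I" "z \<in> I"
  shows "skew y z a \<in> ST I"
  using assms
proof (induction n arbitrary: a y z)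
  case 0
  have "skew y z (word []) \<in> (ST I :: ('i, 'k) zin set)"
    using 0 unfolding bracket_gen_gen[symmetric] by (intro bracket_ST gen_ST)
  then show ?case
    by (intro skew_words_space_deg_induct[OF 0(1) subspace_ST]) simp
next
  case (Suc n)
  have "skew y z (word v) \<in> (ST I :: ('i, 'k) zin set)" if v: "set v \<subseteq> I" "length v = Suc n" for v
  proof -
    obtain w s where w: "v = w @ [s]" using v by (cases v rule: rev_cases) auto
    have sw: "set w \<subseteq> I" "s \<in> I" "length w = n" using v by (auto simp: w)
    have *: "skew y z (word [t] \<star> word w) \<in> (ST I :: ('i, 'k) zin set)"
      if "y \<in> I" "z \<in> I" "t \<in> I" for y z t
    proof -
      \<comment> \<open>Indices 0 and 1 carry the two last letters, and 2 the only letter left to be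
        shuffled.\<close>
      define f where "f = (\<lambda>i::nat. if i = 0 then y else if i = 1 then z else t)"
      have "{0, 1, 2} - {0, 1} = {2::nat}" by auto
      then have e: "shuffle_letters f ({0, 1, 2} - {0, 1}) = (word [t] :: ('i, 'k) zin)"
        by (simp add: shuffle_letters_insert[of "{}"] f_def shm_commute[of _ "word []"] shm_Nil)
      have "skew (f 0) (f 1) (shuffle_letters f ({0, 1, 2} - {0, 1}) \<star> word w) \<in> (ST I :: ('i, 'k) zin set)"
        using that sw by (intro skew_shuffle_letters_in_ST[OF Suc.IH]) (auto simp: f_def)
      then show ?thesis unfolding e by (simp add: f_def)
    qed
    have "zscale 2 (skew y z (app s (word w))) -
      (skew z s (word [y] \<star> word w) + skew s y (word [z] \<star> word w) - skew y z (word [s] \<star> word w))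
      \<in> (ST I :: ('i, 'k) zin set)"
      using Suc.prems sw by (intro skew_app_mod_ST Suc.IH word_words_space_deg) auto
    moreover have "skew z s (word [y] \<star> word w) + skew s y (word [z] \<star> word w) - skew y z (word [s] \<star> word w)
      \<in> (ST I :: ('i, 'k) zin set)"
      using Suc.prems sw by (intro ST_closed *) auto
    ultimately have "zscale 2 (skew y z (app s (word w))) \<in> (ST I :: ('i, 'k) zin set)"
      using zin.subspace_add[OF subspace_ST] by fastforce
    then have "skew y z (app s (word w)) \<in> (ST I :: ('i, 'k) zin set)"
      by (rule subspace_scale_cancel[OF subspace_ST, rotated]) simp
    then show ?thesis by (simp add: w app_simps)
  qed
  then show ?case
    by (rule skew_words_space_deg_induct[OF Suc.prems(1) subspace_ST])
qed


section \<open>The skew-right-commutative elements span a subalgebra\<close>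

text \<open>No order on \<open>y\<close>, \<open>z\<close> is imposed, so closure under the bracket
  needs no case distinction on last letters.\<close>

definition skew_space :: "'i set \<Rightarrow> ('i, 'k::field_char_0) zin set" where
  "skew_space I = zin.span (gen ` I \<union> {skew y z (word u) | y z u. y \<in> I \<and> z \<in> I \<and> set u \<subseteq> I})"

lemma subspace_skew_space: "zin.subspace (skew_space I)"
  by (simp add: skew_space_def)

lemmas skew_space_closed = zin.subspace_add[OF subspace_skew_space] zin.subspace_diff[OF subspace_skew_space]

lemma skew_in_skew_space:
  assumes "y \<in> I" "z \<in> I" "a \<in> words_space I"
  shows "skew y z a \<in> skew_space I"
  using assms(3) unfolding words_space_def
  by (rule span_image_induct[OF _ skew_linear subspace_skew_space])
    (use assms(1,2) in \<open>auto simp: skew_space_def intro!: zin.span_base\<close>)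

lemma gen_in_skew_space: "i \<in> I \<Longrightarrow> gen i \<in> skew_space I"
  by (auto simp: skew_space_def intro: zin.span_base)

lemma bracket_skew_space:
  fixes a b :: "('i, 'k::field_char_0) zin"
  assumes "a \<in> skew_space I" "b \<in> skew_space I"
  shows "bracket a b \<in> skew_space I"
proof -
  let ?G = "gen ` I :: ('i, 'k) zin set"
  let ?D = "{skew y z (word u) | y z u. y \<in> I \<and> z \<in> I \<and> set u \<subseteq> I} :: ('i, 'k) zin set"
  have app: "app y a \<in> words_space I" if "y \<in> I" "a \<in> words_space I" for y and a :: "('i, 'k) zin"
    using that by (rule app_words_space[rotated])
  \<comment> \<open>Skew elements themselves occur inside prefixes, in the first two terms of
    \<open>bracket_skew_skew\<close>.\<close>
  have skew: "skew y z a \<in> words_space I" if "y \<in> I" "z \<in> I" "a \<in> words_space I" for y z and a :: "('i, 'k) zin"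
    using app[OF that(2) app[OF that(1,3)]] app[OF that(1) app[OF that(2,3)]]
    unfolding skew_def words_space_def by (rule zin.span_diff)
  note closed = skew_space_closed skew_in_skew_space app skew shuffle_words_space word_words_space
  have DG: "bracket d g \<in> skew_space I" if dg: "d \<in> ?D" "g \<in> ?G" for d g
  proof -
    obtain y z t u where *: "y \<in> I" "z \<in> I" "t \<in> I" "set u \<subseteq> I" "d = skew y z (word u)" "g = gen t"
      using dg by blast
    show ?thesis unfolding *(5,6) bracket_skew_gen
      using *(1-4) by (intro closed) auto
  qed
  have base: "bracket g h \<in> skew_space I" if gh: "g \<in> ?G \<union> ?D" "h \<in> ?G \<union> ?D" for g h
  proof -
    consider "g \<in> ?G" "h \<in> ?G" | "g \<in> ?D" "h \<in> ?G" | "g \<in> ?G" "h \<in> ?D" | "g \<in> ?D" "h \<in> ?D"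
      using gh by blast
    then show ?thesis
    proof cases
      case 1
      then obtain y z where *: "y \<in> I" "z \<in> I" "g = gen y" "h = gen z" by blast
      show ?thesis unfolding *(3,4) bracket_gen_gen
        using *(1,2) by (intro closed) auto
    next
      case 2
      then show ?thesis by (rule DG)
    next
      case 3
      show ?thesis unfolding bracket_swap[of g]
        by (rule zin.subspace_neg[OF subspace_skew_space DG[OF 3(2,1)]])
    next
      case 4
      obtain y z u where *: "y \<in> I" "z \<in> I" "set u \<subseteq> I" "g = skew y z (word u)"
        using 4(1) by blast
      obtain s t v where **: "s \<in> I" "t \<in> I" "set v \<subseteq> I" "h = skew s t (word v)"
        using 4(2) by blast
      show ?thesis unfolding *(4) **(4) bracket_skew_skew
        using *(1-3) **(1-3) by (intro closed) auto
    qed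
  qed
  have "bracket g b \<in> skew_space I" if "g \<in> ?G \<union> ?D" for g
    using assms(2) unfolding skew_space_def[of I]
    by (rule span_image_induct[OF _ bracket_linear_right zin.subspace_span])
      (rule base[OF that, unfolded skew_space_def[of I]])
  then show ?thesis
    using assms(1) unfolding skew_space_def[of I]
    by (rule span_image_induct[OF _ bracket_linear_left zin.subspace_span, rotated])
qed

lemma skew_space_subset_zin: "skew_space I \<subseteq> zin I"
  unfolding skew_space_def
proof (rule zin.span_minimal[OF _ subspace_zin], rule Un_least)
  show "gen ` I \<subseteq> zin I" by (auto simp: gen_def)
next
  show "{skew y z (word u) | y z u. y \<in> I \<and> z \<in> I \<and> set u \<subseteq> I} \<subseteq> zin I"
    by (auto simp: skew_word intro!: zin.subspace_diff[OF subspace_zin])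
qed

text \<open>One inclusion is the minimality of \<open>ST I\<close> among subalgebras containing the
  generators, the other is \<open>skew_in_ST\<close>.\<close>

lemma ST_eq_skew_space: "ST I = skew_space I"
proof
  show "ST I \<subseteq> skew_space I"
    unfolding ST_def
    by (rule Inter_lower)
      (simp add: skew_space_subset_zin subspace_skew_space bracket_skew_space gen_in_skew_space image_subset_iff)
  have "skew y z (word u) \<in> ST I" if "y \<in> I" "z \<in> I" "set u \<subseteq> I" for y z u
    using that by (intro skew_in_ST[OF word_words_space_deg[OF _ refl]])
  then show "skew_space I \<subseteq> ST I"
    unfolding skew_space_def
    by (intro zin.span_minimal[OF _ subspace_ST]) (auto intro: gen_ST)
qed


section \<open>Bases\<close>

text \<open>The coefficient at \<open>c i\<close> vanishes on the span of all members other than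
  \<open>b i\<close>, but is 1 at \<open>b i\<close>.\<close>

lemma dual_family_independent:
  assumes dual: "\<And>i j. i \<in> J \<Longrightarrow> j \<in> J \<Longrightarrow> Poly_Mapping.lookup (b i) (c j) = (if i = j then 1 else 0)"
  shows "inj_on b J" "zin.independent (b ` J)"
proof -
  show inj: "inj_on b J"
  proof (rule inj_onI)
    fix i j assume ij: "i \<in> J" "j \<in> J" "b i = b j"
    then have "(if j = i then 1 else 0) = (1 :: 'b)"
      using dual[OF ij(2,1)] dual[OF ij(1,1)] by simp
    then show "i = j" by (simp split: if_splits)
  qed
  show "zin.independent (b ` J)"
    unfolding zin.dependent_def
  proof
    assume "\<exists>a\<in>b ` J. a \<in> zin.span (b ` J - {a})"
    then obtain i where i: "i \<in> J" "b i \<in> zin.span (b ` J - {b i})" by blast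
    let ?V = "{a. Poly_Mapping.lookup a (c i) = 0}"
    have "b ` J - {b i} \<subseteq> ?V"
    proof
      fix x assume "x \<in> b ` J - {b i}"
      then obtain j where "j \<in> J" "x = b j" "j \<noteq> i" by blast
      then show "x \<in> ?V" using dual[OF _ i(1), of j] by simp
    qed
    moreover have "zin.subspace ?V" by (rule zin.subspaceI) (auto simp: lookup_add)
    ultimately have "b i \<in> ?V" by (rule subsetD[OF zin.span_minimal i(2)])
    then show False using dual[OF i(1) i(1)] by simp
  qed
qed

text \<open>The inclusion of the left side is seen by applying the projection onto the words
  satisfying \<open>Q\<close>.\<close>
lemma span_family_restrict:
  fixes b :: "'j \<Rightarrow> ('i, 'k::field_char_0) zin"
  assumes Q: "\<And>j w. j \<in> J \<Longrightarrow> w \<in> Poly_Mapping.keys (b j) \<Longrightarrow> Q w \<longleftrightarrow> Q (c j)"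
  shows "{a \<in> zin.span (b ` J). \<forall>w\<in>Poly_Mapping.keys a. Q w} = zin.span (b ` {j \<in> J. Q (c j)})"
    (is "?L = ?R")
proof
  define proj :: "('i, 'k) zin \<Rightarrow> ('i, 'k) zin" where
    "proj = lin zscale (\<lambda>w. if Q w then word w else 0)"
  have lin: "module_hom zscale zscale proj"
    by unfold_locales (simp_all add: proj_def zlin_simps)
  have id: "proj a = a" if "\<forall>w\<in>Poly_Mapping.keys a. Q w" for a
  proof -
    have "proj a = (\<Sum>w\<in>Poly_Mapping.keys a. zscale (Poly_Mapping.lookup a w) (word w))"
      using that by (simp add: proj_def lin_def)
    then show ?thesis by (simp only: zin_expand[symmetric])
  qed
  have zero: "proj a = 0" if "\<forall>w\<in>Poly_Mapping.keys a. \<not> Q w" for a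
    using that by (simp add: proj_def lin_def)
  show "?L \<subseteq> ?R"
  proof
    fix a assume a: "a \<in> ?L"
    then have "a \<in> zin.span (b ` J)" by simp
    then have "proj a \<in> ?R"
    proof (rule span_image_induct[OF _ lin zin.subspace_span])
      fix x assume "x \<in> b ` J"
      then obtain j where j: "j \<in> J" "x = b j" by blast
      show "proj x \<in> ?R"
      proof (cases "Q (c j)")
        case True
        then have "proj x = x" using Q[OF j(1)] j(2) by (intro id) auto
        then show ?thesis using j True by (auto intro: zin.span_base)
      next
        case False
        then have "proj x = 0" using Q[OF j(1)] j(2) by (intro zero) auto
        then show ?thesis by (simp add: zin.span_zero)
      qed
    qed
    then show "a \<in> ?R" using a id by simp
  qed
  let ?V = "{a :: ('i, 'k) zin. \<forall>w\<in>Poly_Mapping.keys a. Q w}"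
  have "zin.subspace ?V"
  proof (rule zin.subspaceI)
    fix x y :: "('i, 'k) zin" assume "x \<in> ?V" "y \<in> ?V"
    then show "x + y \<in> ?V" using keys_add[of x y] by blast
  qed (auto simp: in_keys_iff)
  moreover have "b ` {j \<in> J. Q (c j)} \<subseteq> ?V" using Q by auto
  ultimately have "?R \<subseteq> ?V" by (intro zin.span_minimal)
  moreover have "?R \<subseteq> zin.span (b ` J)" by (rule zin.span_mono) auto
  ultimately show "?R \<subseteq> ?L" by blast
qed

section \<open>The basis of generators and skew-right-commutative elements\<close>

lemma Gamma_iff:
  "\<alpha> \<in> Gamma I \<longleftrightarrow> (\<exists>u y z. \<alpha> = u @ [y, z] \<and> set u \<subseteq> I \<and> y \<in> I \<and> z \<in> I \<and> y < z)"
proof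
  assume \<alpha>: "\<alpha> \<in> Gamma I"
  obtain v z where v: "\<alpha> = v @ [z]" using \<alpha> by (cases \<alpha> rule: rev_cases) (auto simp: Gamma_def)
  obtain u y where "v = u @ [y]" using \<alpha> v by (cases v rule: rev_cases) (auto simp: Gamma_def)
  with v have "\<alpha> = u @ [y, z]" by simp
  then show "\<exists>u y z. \<alpha> = u @ [y, z] \<and> set u \<subseteq> I \<and> y \<in> I \<and> z \<in> I \<and> y < z"
    using \<alpha> by (auto simp: Gamma_def nth_append)
qed (auto simp: Gamma_def nth_append)

lemma overline_lbr_skew: "overline (lbr (u @ [y, z])) = skew y z (word u)"
  unfolding overline_lbr by (simp add: lbr_eq_word skew_word)

lemma lookup_skew_word:
  "Poly_Mapping.lookup (skew y z (word u) :: ('i, 'k::field_char_0) zin) w =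
    (if w = u @ [y, z] then 1 else 0) - (if w = u @ [z, y] then 1 else 0)"
  unfolding skew_word lookup_minus by (simp add: word_def lookup_single when_def eq_commute[of w])

text \<open>A sum type indexes both kinds of elements, so that injectivity also keeps them apart
  from each other.\<close>

definition ST_basis :: "'i + 'i list \<Rightarrow> ('i, 'k::field_char_0) zin" where
  "ST_basis = case_sum gen (\<lambda>\<alpha>. overline (lbr \<alpha>))"

definition lead_word :: "'i + 'i list \<Rightarrow> 'i list" where
  "lead_word = case_sum (\<lambda>i. [i]) id"

text \<open>For \<open>y < z\<close> the negative word \<open>u @ [z, y]\<close> is not in
  \<open>Gamma I\<close>, hence it is no lead word of any basis element.\<close>

lemma ST_basis_dual:
  assumes "i \<in> I <+> Gamma I" "j \<in> I <+> Gamma I"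
  shows "Poly_Mapping.lookup (ST_basis i) (lead_word j) = (if i = j then 1 else 0)"
  using assms
  by (auto simp: ST_basis_def lead_word_def gen_def Gamma_iff overline_lbr_skew lookup_skew_word)
    (auto simp: word_def lookup_single split: if_splits)

text \<open>By antisymmetry of \<open>skew\<close>, elements with decreasing last letters are
  negatives of basis elements, and equal last letters give 0.\<close>

lemma span_ST_basis:
  fixes I :: "'i::linorder set"
  shows "zin.span (ST_basis ` (I <+> Gamma I)) = (ST I :: ('i, 'k::field_char_0) zin set)"
proof -
  let ?B = "ST_basis ` (I <+> Gamma I) :: ('i, 'k) zin set"
  have gen: "gen i \<in> ?B" if "i \<in> I" for i
    using that by (intro image_eqI[of _ _ "Inl i"]) (auto simp: ST_basis_def)
  have less: "skew y z (word u) \<in> ?B" if "y \<in> I" "z \<in> I" "set u \<subseteq> I" "y < z" for y z u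
    using that by (intro image_eqI[of _ _ "Inr (u @ [y, z])"])
      (auto simp: ST_basis_def Gamma_iff overline_lbr_skew)
  have skew: "skew y z (word u) \<in> zin.span ?B" if "y \<in> I" "z \<in> I" "set u \<subseteq> I" for y z u
  proof (cases y z rule: linorder_cases)
    case greater
    then have "- skew z y (word u) \<in> zin.span ?B"
      using less that by (intro zin.span_neg zin.span_base)
    then show ?thesis by (simp add: skew_swap[of y z])
  qed (use less that in \<open>auto intro: zin.span_base zin.span_zero\<close>)
  have "?B \<subseteq> skew_space I"
    by (auto simp: ST_basis_def Gamma_iff overline_lbr_skew intro!: gen_in_skew_space skew_in_skew_space word_words_space)
  moreover have "skew_space I \<subseteq> zin.span ?B"
    unfolding skew_space_def
    by (intro zin.span_minimal[OF _ zin.subspace_span]) (auto intro: zin.span_base[OF gen] skew)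
  ultimately show ?thesis
    unfolding ST_eq_skew_space
    by (intro subset_antisym zin.span_minimal[OF _ subspace_skew_space])
qed

text \<open>The two words of a skew element differ by a swap of the last two letters, so each basis
  element lies wholly inside or wholly outside the part cut out by \<open>Q\<close>. Lengths and
  letter counts are such properties.\<close>

lemma basis_family_ST_restrict:
  fixes I :: "'i::linorder set"
  assumes swap: "\<And>u y z. Q (u @ [y, z]) \<longleftrightarrow> Q (u @ [z, y])"
  shows "basis_family ST_basis {j \<in> I <+> Gamma I. Q (lead_word j)}
    {a \<in> (ST I :: ('i, 'k::field_char_0) zin set). \<forall>w\<in>Poly_Mapping.keys a. Q w}"
proof -
  let ?J = "{j \<in> I <+> Gamma I. Q (lead_word j)}"
  have "Q w \<longleftrightarrow> Q (lead_word j)"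
    if "j \<in> I <+> Gamma I" "w \<in> Poly_Mapping.keys (ST_basis j :: ('i, 'k) zin)" for j w
    using that(1)
  proof (rule PlusE)
    fix i assume "i \<in> I" "j = Inl i"
    then show ?thesis using that(2) by (simp add: ST_basis_def lead_word_def gen_def word_def)
  next
    fix \<alpha> assume "\<alpha> \<in> Gamma I" "j = Inr \<alpha>"
    then obtain u y z where j: "j = Inr (u @ [y, z])" by (auto simp: Gamma_iff)
    have "w = u @ [y, z] \<or> w = u @ [z, y]"
      using that(2)
      by (auto simp: j ST_basis_def overline_lbr_skew lookup_skew_word in_keys_iff split: if_splits)
    then show ?thesis using swap by (auto simp: j lead_word_def)
  qed
  then have "{a \<in> zin.span (ST_basis ` (I <+> Gamma I)). \<forall>w\<in>Poly_Mapping.keys a. Q w} =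
      (zin.span (ST_basis ` ?J) :: ('i, 'k) zin set)"
    by (rule span_family_restrict)
  moreover have "inj_on ST_basis ?J" "zin.independent (ST_basis ` ?J :: ('i, 'k) zin set)"
    by (rule dual_family_independent[where c = lead_word], rule ST_basis_dual[of _ I]; simp)+
  ultimately show ?thesis by (simp add: basis_family_def span_ST_basis)
qed

lemma basis_family_image:
  assumes "inj_on h J" "basis_family b (h ` J) V"
  shows "basis_family (b \<circ> h) J V"
  using assms comp_inj_on[of h J b] by (simp add: basis_family_def image_comp)

lemma basis_family_Inr:
  assumes "basis_family ST_basis (Inr ` J) V"
  shows "basis_family (\<lambda>\<alpha>. overline (lbr \<alpha>)) J V"
proof -
  have "basis_family (ST_basis \<circ> Inr) J V"
    using assms by (intro basis_family_image) auto
  then show ?thesis by (simp add: ST_basis_def comp_def)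
qed

lemma basis_family_ST:
  "basis_family ST_basis (I <+> Gamma I) (ST I :: ('i::linorder, 'k::field_char_0) zin set)"
  using basis_family_ST_restrict[of "\<lambda>_. True" I] by simp

lemma basis_family_ST_ge2:
  fixes I :: "'i::linorder set"
  shows "basis_family (\<lambda>\<alpha>. overline (lbr \<alpha>)) (Gamma I) (ST_ge2 I :: ('i, 'k::field_char_0) zin set)"
proof (rule basis_family_Inr)
  have "{j \<in> I <+> Gamma I. 2 \<le> length (lead_word j)} = Inr ` Gamma I"
    by (auto simp: lead_word_def Gamma_def)
  then show "basis_family ST_basis (Inr ` Gamma I) (ST_ge2 I :: ('i, 'k) zin set)"
    using basis_family_ST_restrict[of "\<lambda>w. 2 \<le> length w" I] by (simp add: ST_ge2_def)
qed

lemma dim_basis_family: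
  assumes "basis_family b J V" "finite J"
  shows "fin_dim V" "zin.dim V = card J"
proof -
  show "fin_dim V" using assms unfolding fin_dim_def basis_family_def by blast
  show "zin.dim V = card J"
    using assms zin.dim_span_eq_card_independent card_image unfolding basis_family_def by metis
qed


section \<open>Dimensions\<close>

text \<open>Taking away one copy each of \<open>i\<close> and \<open>j\<close> divides the product
  of factorials by \<open>m i * m j\<close>.\<close>

lemma prod_fact_remove_two:
  fixes m :: "'i \<Rightarrow> nat"
  assumes "finite A" "i \<in> A" "j \<in> A" "i \<noteq> j" "0 < m i" "0 < m j"
  shows "(\<Prod>k\<in>A. fact (m k) :: real) =
    (\<Prod>k\<in>A. fact (m k - (if k = i then 1 else 0) - (if k = j then 1 else 0))) * real (m i) * real (m j)"
proof -
  have "(fact (m k) :: real) = fact (m k - (if k = i then 1 else 0) - (if k = j then 1 else 0)) *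
      (if k = i then real (m i) else 1) * (if k = j then real (m j) else 1)" for k
    using assms(4-6) by (auto simp: fact_reduce)
  then have "(\<Prod>k\<in>A. fact (m k) :: real) =
      (\<Prod>k\<in>A. fact (m k - (if k = i then 1 else 0) - (if k = j then 1 else 0))) *
      (\<Prod>k\<in>A. if k = i then real (m i) else 1) * (\<Prod>k\<in>A. if k = j then real (m j) else 1)"
    by (simp only: prod.distrib)
  then show ?thesis using assms(1-3) by (simp add: prod.delta)
qed

text \<open>Such a word is a pair \<open>i < j\<close> of last letters preceded by an arbitrary
  arrangement of the remaining multiset of letters. The arrangements are counted by a multinomial
  coefficient.\<close>

lemma card_Gamma_count:
  fixes m :: "'i::linorder \<Rightarrow> nat"
  assumes I: "finite I" and pos: "\<forall>i\<in>I. 0 < m i"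
  shows "finite {\<alpha> \<in> Gamma I. \<forall>i\<in>I. count_list \<alpha> i = m i}"
    and "real (card {\<alpha> \<in> Gamma I. \<forall>i\<in>I. count_list \<alpha> i = m i}) =
      (\<Sum>(i, j)\<in>{(i, j). i \<in> I \<and> j \<in> I \<and> i < j}.
        fact ((\<Sum>i\<in>I. m i) - 2) / (\<Prod>k\<in>I. fact (m k)) * real (m i) * real (m j))"
proof -
  let ?P = "{(i, j). i \<in> I \<and> j \<in> I \<and> i < j}"
  define M where "M = (\<Sum>k\<in>I. replicate_mset (m k) k)"
  have count_M: "count M k = (if k \<in> I then m k else 0)" for k
    using I by (simp add: M_def count_sum)
  have set_M: "set_mset M \<subseteq> I"
    by (auto simp: count_M simp flip: count_greater_zero_iff split: if_splits)
  have size_M: "size M = (\<Sum>i\<in>I. m i)"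
    by (simp add: M_def size_multiset_sum)
  let ?perms = "\<lambda>(i, j). permutations_of_multiset (M - {#i, j#})"
  have fin_P: "finite ?P"
    by (rule finite_subset[of _ "I \<times> I"]) (use I in auto)
  \<comment> \<open>Positive multiplicities and \<open>i < j\<close> guarantee that both letters can
    be removed, so no subtraction below is truncated.\<close>
  have sub: "{#i, j#} \<subseteq># M" if "(i, j) \<in> ?P" for i j
    using that pos by (auto simp: subseteq_mset_def count_M Suc_le_eq)
  have mset_iff: "set \<alpha> \<subseteq> I \<and> (\<forall>i\<in>I. count_list \<alpha> i = m i) \<longleftrightarrow> mset \<alpha> = M" for \<alpha>
  proof
    assume \<alpha>: "set \<alpha> \<subseteq> I \<and> (\<forall>i\<in>I. count_list \<alpha> i = m i)"
    show "mset \<alpha> = M"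
    proof (rule multiset_eqI)
      fix k
      show "count (mset \<alpha>) k = count M k"
        using \<alpha> by (cases "k \<in> I") (auto simp: count_M count_mset count_list_0_iff)
    qed
  next
    assume \<alpha>: "mset \<alpha> = M"
    then have "set \<alpha> \<subseteq> I" using set_M by (metis set_mset_mset)
    moreover have "count_list \<alpha> i = m i" if "i \<in> I" for i
      using that \<alpha> count_M[of i] by (metis count_mset)
    ultimately show "set \<alpha> \<subseteq> I \<and> (\<forall>i\<in>I. count_list \<alpha> i = m i)" by blast
  qed
  have G: "{\<alpha> \<in> Gamma I. \<forall>i\<in>I. count_list \<alpha> i = m i} = (\<lambda>((i, j), u). u @ [i, j]) ` Sigma ?P ?perms"
    (is "?G = ?h ` _")
  proof (intro subset_antisym subsetI)
    fix \<alpha> assume \<alpha>: "\<alpha> \<in> ?G"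
    then obtain u i j where *: "\<alpha> = u @ [i, j]" "i \<in> I" "j \<in> I" "i < j"
      by (auto simp: Gamma_iff)
    have "mset \<alpha> = M" using \<alpha> mset_iff[of \<alpha>] by (auto simp: Gamma_def)
    then have "mset u = M - {#i, j#}" by (auto simp: *(1))
    with * show "\<alpha> \<in> ?h ` Sigma ?P ?perms"
      by (intro image_eqI[of _ _ "((i, j), u)"]) (auto intro: permutations_of_multisetI)
  next
    fix \<alpha> assume "\<alpha> \<in> ?h ` Sigma ?P ?perms"
    then obtain u i j where *: "\<alpha> = u @ [i, j]" "(i, j) \<in> ?P" "mset u = M - {#i, j#}"
      by (auto dest: permutations_of_multisetD)
    have "mset \<alpha> = mset u + {#i, j#}" by (simp add: *(1))
    also have "\<dots> = M" unfolding *(3) by (rule subset_mset.diff_add[OF sub[OF *(2)]])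
    finally have "set \<alpha> \<subseteq> I \<and> (\<forall>i\<in>I. count_list \<alpha> i = m i)" using mset_iff by blast
    then show "\<alpha> \<in> ?G" using * by (auto simp: Gamma_iff)
  qed
  show "finite ?G"
    unfolding G using fin_P by (intro finite_imageI finite_SigmaI) auto
  have "card ?G = card (Sigma ?P ?perms)"
    unfolding G by (rule card_image) (auto intro!: inj_onI)
  also have "\<dots> = (\<Sum>p\<in>?P. card (?perms p))"
    using fin_P by (intro card_SigmaI) auto
  finally have "real (card ?G) = (\<Sum>p\<in>?P. real (card (?perms p)))" by simp
  also have "\<dots> = (\<Sum>(i, j)\<in>?P.
      fact ((\<Sum>i\<in>I. m i) - 2) / (\<Prod>k\<in>I. fact (m k)) * real (m i) * real (m j))"
  proof (rule sum.cong[OF refl], safe)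
    fix i j assume ij: "i \<in> I" "j \<in> I" "i < j"
    let ?N = "M - {#i, j#}"
    have "size ?N = (\<Sum>i\<in>I. m i) - 2"
      using sub[of i j] ij by (simp add: size_Diff_submset size_M)
    moreover have "real (card (permutations_of_multiset ?N)) * (\<Prod>x\<in>set_mset ?N. fact (count ?N x))
        = fact (size ?N)"
      using card_permutations_of_multiset_aux[of ?N, THEN arg_cong[of _ _ real]] by simp
    moreover have "(\<Prod>x\<in>set_mset ?N. fact (count ?N x) :: real) = (\<Prod>x\<in>I. fact (count ?N x))"
    proof (rule prod.mono_neutral_left[OF I])
      show "set_mset ?N \<subseteq> I" using set_M by (auto dest: in_diffD)
      \<comment> \<open>A letter used up by the last two positions contributes the factorial of
        0.\<close>
      show "\<forall>x\<in>I - set_mset ?N. (fact (count ?N x) :: real) = 1"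
        by (auto simp: not_in_iff simp del: count_diff)
    qed
    moreover have "count ?N x = m x - (if x = i then 1 else 0) - (if x = j then 1 else 0)"
      if "x \<in> I" for x
      using that ij by (auto simp: count_M)
    ultimately have "real (card (permutations_of_multiset ?N)) *
        (\<Prod>x\<in>I. fact (m x - (if x = i then 1 else 0) - (if x = j then 1 else 0))) =
        fact ((\<Sum>i\<in>I. m i) - 2)"
      by simp
    then have "real (card (permutations_of_multiset ?N)) * (\<Prod>k\<in>I. fact (m k)) =
        fact ((\<Sum>i\<in>I. m i) - 2) * real (m i) * real (m j)"
      using prod_fact_remove_two[OF I ij(1,2), of m] ij pos by (simp add: mult.assoc[symmetric])
    moreover have "(\<Prod>k\<in>I. fact (m k) :: real) \<noteq> 0"
      using I by simp
    ultimately show "real (card (permutations_of_multiset ?N)) =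
        fact ((\<Sum>i\<in>I. m i) - 2) / (\<Prod>k\<in>I. fact (m k)) * real (m i) * real (m j)"
      by (simp add: field_simps)
  qed
  finally show "real (card ?G) = (\<Sum>(i, j)\<in>?P.
      fact ((\<Sum>i\<in>I. m i) - 2) / (\<Prod>k\<in>I. fact (m k)) * real (m i) * real (m j))" .
qed

section \<open>Homogeneous components\<close>

lemma basis_family_ST_hom:
  fixes I :: "'i::linorder set" and m :: "'i \<Rightarrow> nat"
  assumes "finite I" "2 \<le> (\<Sum>i\<in>I. m i)"
  shows "basis_family (\<lambda>\<alpha>. overline (lbr \<alpha>)) {\<alpha> \<in> Gamma I. \<forall>i\<in>I. count_list \<alpha> i = m i}
    (ST_hom I m :: ('i, 'k::field_char_0) zin set)"
proof (rule basis_family_Inr)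
  let ?Q = "\<lambda>w. \<forall>i\<in>I. count_list w i = m i"
  \<comment> \<open>A one-letter word has total degree 1, so degree at least 2 excludes the
    generators.\<close>
  have "\<not> ?Q [k]" if "k \<in> I" for k
  proof
    assume "?Q [k]"
    then have "(\<Sum>i\<in>I. m i) = (\<Sum>i\<in>I. if i = k then 1 else 0)"
      by (intro sum.cong) auto
    then show False using assms that by simp
  qed
  then have "{j \<in> I <+> Gamma I. ?Q (lead_word j)} = Inr ` {\<alpha> \<in> Gamma I. ?Q \<alpha>}"
    by (auto simp: lead_word_def simp del: count_list.simps) blast
  moreover have "basis_family ST_basis {j \<in> I <+> Gamma I. ?Q (lead_word j)}
      {a \<in> (ST I :: ('i, 'k) zin set). \<forall>w\<in>Poly_Mapping.keys a. ?Q w}"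
    by (rule basis_family_ST_restrict, intro ball_cong refl) auto
  ultimately show "basis_family ST_basis (Inr ` {\<alpha> \<in> Gamma I. ?Q \<alpha>}) (ST_hom I m :: ('i, 'k) zin set)"
    by (simp add: ST_hom_def)
qed

lemma dim_ST_hom:
  fixes m :: "'i::linorder \<Rightarrow> nat"
  assumes "finite I" "\<forall>i\<in>I. 0 < m i" "2 \<le> (\<Sum>i\<in>I. m i)"
  shows "fin_dim (ST_hom I m :: ('i, 'k::field_char_0) zin set)"
    and "real (zin.dim (ST_hom I m :: ('i, 'k) zin set)) =
      (\<Sum>(i, j)\<in>{(i, j). i \<in> I \<and> j \<in> I \<and> i < j}.
        fact ((\<Sum>i\<in>I. m i) - 2) / (\<Prod>k\<in>I. fact (m k)) * real (m i) * real (m j))"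
proof -
  note dim = dim_basis_family[OF basis_family_ST_hom[OF assms(1,3)] card_Gamma_count(1)[OF assms(1,2)]]
  show "fin_dim (ST_hom I m :: ('i, 'k) zin set)" by (rule dim(1))
  have "zin.dim (ST_hom I m :: ('i, 'k) zin set) = card {\<alpha> \<in> Gamma I. \<forall>i\<in>I. count_list \<alpha> i = m i}"
    by (rule dim(2))
  then show "real (zin.dim (ST_hom I m :: ('i, 'k) zin set)) =
      (\<Sum>(i, j)\<in>{(i, j). i \<in> I \<and> j \<in> I \<and> i < j}.
        fact ((\<Sum>i\<in>I. m i) - 2) / (\<Prod>k\<in>I. fact (m k)) * real (m i) * real (m j))"
    using card_Gamma_count(2)[OF assms(1,2)] by simp
qed

section \<open>The multilinear part and the conclusion\<close>

lemma card_increasing_pairs: "real (card {(i, j). 1 \<le> i \<and> i < j \<and> j \<le> q}) = real q * (real q - 1) / 2"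
proof (induction q)
  case (Suc q)
  let ?P = "\<lambda>q. {(i, j). 1 \<le> i \<and> i < j \<and> j \<le> (q :: nat)}"
  have P: "?P (Suc q) = ?P q \<union> (\<lambda>i. (i, Suc q)) ` {1..q}" by auto
  have "finite (?P q)" by (rule finite_subset[of _ "{1..q} \<times> {1..q}"]) auto
  then have "card (?P (Suc q)) = card (?P q) + q"
    unfolding P by (subst card_Un_disjoint) (auto simp: card_image inj_on_def)
  with Suc show ?case by (simp add: field_simps)
next
  case 0
  have "{(i, j). 1 \<le> i \<and> i < j \<and> j \<le> (0 :: nat)} = {}" by auto
  then show ?case by (metis card.empty mult_zero_left div_0 of_nat_0)
qed

theorem theorem2p2:
  fixes I :: "'i::linorder set"
  shows
    "basis_family (case_sum gen (\<lambda>\<alpha>. overline (lbr \<alpha>))) (I <+> Gamma I)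
       (ST I :: ('i, 'k::field_char_0) zin set)
     \<and> basis_family (\<lambda>\<alpha>. overline (lbr \<alpha>)) (Gamma I) (ST_ge2 I :: ('i, 'k) zin set)
     \<and> (\<forall>(q::nat) (m :: nat \<Rightarrow> nat) n.
          (\<forall>i\<in>{1..q}. 0 < m i) \<and> n = (\<Sum>i=1..q. m i) \<and> 2 \<le> n \<longrightarrow>
          fin_dim (ST_hom {1..q} m :: (nat, 'k) zin set) \<and>
          real (zin.dim (ST_hom {1..q} m :: (nat, 'k) zin set)) =
            (\<Sum>(i, j) \<in> {(i, j). 1 \<le> i \<and> i < j \<and> j \<le> q}.
               fact (n - 2) / (\<Prod>k=1..q. fact (m k)) * real (m i) * real (m j)))
     \<and> (\<forall>q::nat. 2 \<le> q \<longrightarrow>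
          fin_dim (ST_hom {1..q} (\<lambda>_. 1) :: (nat, 'k) zin set) \<and>
          real (zin.dim (ST_hom {1..q} (\<lambda>_. 1) :: (nat, 'k) zin set)) = fact q / 2)"
proof (intro conjI allI impI)
  show "basis_family (case_sum gen (\<lambda>\<alpha>. overline (lbr \<alpha>))) (I <+> Gamma I) (ST I :: ('i, 'k) zin set)"
    using basis_family_ST by (simp only: ST_basis_def)
  show "basis_family (\<lambda>\<alpha>. overline (lbr \<alpha>)) (Gamma I) (ST_ge2 I :: ('i, 'k) zin set)"
    by (rule basis_family_ST_ge2)
next
  fix q n :: nat and m :: "nat \<Rightarrow> nat"
  assume m: "(\<forall>i\<in>{1..q}. 0 < m i) \<and> n = (\<Sum>i=1..q. m i) \<and> 2 \<le> n"
  have P: "{(i, j). i \<in> {1..q} \<and> j \<in> {1..q} \<and> i < j} = {(i, j). 1 \<le> i \<and> i < j \<and> j \<le> q}" by auto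
  show "fin_dim (ST_hom {1..q} m :: (nat, 'k) zin set)"
    using m by (intro dim_ST_hom) auto
  show "real (zin.dim (ST_hom {1..q} m :: (nat, 'k) zin set)) =
      (\<Sum>(i, j) \<in> {(i, j). 1 \<le> i \<and> i < j \<and> j \<le> q}.
         fact (n - 2) / (\<Prod>k=1..q. fact (m k)) * real (m i) * real (m j))"
    using m dim_ST_hom(2)[of "{1..q}" m, where 'k = 'k, unfolded P] by simp
next
  fix q :: nat assume q: "2 \<le> q"
  have P: "{(i, j). i \<in> {1..q} \<and> j \<in> {1..q} \<and> i < j} = {(i, j). 1 \<le> i \<and> i < j \<and> j \<le> q}" by auto
  show "fin_dim (ST_hom {1..q} (\<lambda>_. 1) :: (nat, 'k) zin set)"
    using q by (intro dim_ST_hom) auto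
  \<comment> \<open>All multiplicities and their factorials are 1, so each pair contributes the same
    summand.\<close>
  have "real (zin.dim (ST_hom {1..q} (\<lambda>_. 1) :: (nat, 'k) zin set)) =
      (\<Sum>(i, j) \<in> {(i, j). 1 \<le> i \<and> i < j \<and> j \<le> q}. fact (q - 2))"
    using q dim_ST_hom(2)[of "{1..q}" "\<lambda>_. 1", where 'k = 'k, unfolded P] by simp
  also have "\<dots> = real (card {(i, j). 1 \<le> i \<and> i < j \<and> j \<le> q}) * fact (q - 2)"
    by (simp add: case_prod_unfold)
  also have "\<dots> = real q * (real q - 1) / 2 * fact (q - 2)"
    unfolding card_increasing_pairs ..
  also have "\<dots> = fact q / 2"
  proof -
    have "fact q = real q * (real (q - 1) * fact (q - 2))"
      using q fact_reduce[of q, where 'a = real] fact_reduce[of "q - 1", where 'a = real]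
      by (simp add: numeral_2_eq_2)
    with q show ?thesis by (simp add: of_nat_diff)
  qed
  finally show "real (zin.dim (ST_hom {1..q} (\<lambda>_. 1) :: (nat, 'k) zin set)) = fact q / 2" .
qed

end
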